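(* Let $J$ be the monic Jacobi matrix associated with a nonrational function $F\in\mathbf N_{-\infty}$, let $s_{-1}\in\mathbb R$, and let $J=\mathfrak U\mathfrak L$ be the block $UL$-factorization of $J$ corresponding to the parameter $s_{-1}$. Then $\mathfrak J=\mathfrak L\mathfrak U$ is the monic generalized Jacobi matrix associated with the function $\frac{F(\lambda)}{\lambda}-\frac{s_{-1}}{\lambda}\in\mathbf D^+_{-\infty}$.
   Context: $\lambda\widehat\to\infty$ means that $\lambda\to\infty$ inside a sector $\varepsilon<\arg\lambda<\pi-\varepsilon$, $\varepsilon>0$. $\mathbf N$ is the class of Nevanlinna functions (analytic in $\mathbb C_+$, mapping $\mathbb C_+$ into $\mathbb C_+$). $\mathbf N_{-\infty}$ is the set of $F\in\mathbf N$ for which there are real $s_0,s_1,\dots$ with $F(\lambda)=-\frac{s_0}{\lambda}-\dots-\frac{s_{2n}}{\lambda^{2n+1}}+o(\lambda^{-2n-1})$, $\lambda\widehat\to\infty$, for every $n\in\mathbb Z_+$ (written $F(\lambda)\sim-\sum_j s_j\lambda^{-j-1}$); equivalently $F(\lambda)=\int_{\mathbb R}\frac{d\sigma(t)}{t-\lambda}$ with a finite measure $\sigma$ with moments $s_j=\int t^jd\sigma(t)$. The polynomials of the first kind $P_j$ are the monic orthogonal polynomials of $\sigma/s_0$: $\lambda P_j=P_{j+1}+b_jP_j+c_{j-1}P_{j-1}$, $P_{-1}=0$, $P_0=1$, $b_j\in\mathbb R$, $c_j>0$; those of the second kind are $Q_j(\lambda)=\int\frac{P_j(\lambda)-P_j(t)}{\lambda-t}d\sigma(t)$.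 The monic Jacobi matrix $J$ associated with $F$ is the semi-infinite tridiagonal matrix with $J_{j,j}=b_j$, $J_{j,j+1}=1$, $J_{j+1,j}=c_j$. $\mathbf D^+_{-\infty}$: functions $\mathfrak F$ meromorphic in $\mathbb C_+$ with $\mathfrak F(\lambda)\sim-\sum_{j\ge0}\mathfrak s_j\lambda^{-j-1}$, $\mathfrak s_j\in\mathbb R$, and $\lambda\mathfrak F(\lambda)+\mathfrak s_0\in\mathbf N_{-\infty}$. $\mathbf D^-_{-\infty}$: functions $\mathfrak F$ meromorphic in $\mathbb C_+$ such that for some $\mathfrak s_{-1}\in\mathbb R\setminus\{0\}$ one has $-\frac{\mathfrak s_{-1}}{\lambda}+\frac{\mathfrak F(\lambda)}{\lambda}\in\mathbf N_{-\infty}$. Normal indices of a real sequence $\{\mathfrak s_j\}_{j\ge0}$: the integers $n\ge1$ with $\det(\mathfrak s_{i+k})_{i,k=0}^{n-1}\neq0$, listed increasingly $\mathfrak n_1<\mathfrak n_2<\cdots$; $\mathfrak n_0=0$, $\mathfrak k_j=\mathfrak n_{j+1}-\mathfrak n_j$ (always $\mathfrak k_j\in\{1,2\}$ here). Generalized Jacobi matrix: let $\mathfrak F\in\mathbf D^\pm_{-\infty}$ be nonrational with $\mathfrak F\sim-\sum\mathfrak s_j\lambda^{-j-1}$. It is normalized if its first nonzero coefficient $\mathfrak s_{\mathfrak n_1-1}$ has modulus $1$. For normalized $\mathfrak F$ put $\mathfrak F_0=\mathfrak F$ and define recursively $-1/\mathfrak F_j(\lambda)=\epsilon_j\mathfrak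 p_j(\lambda)+\mathfrak b_j^2\mathfrak F_{j+1}(\lambda)$, where $\epsilon_j=\pm1$ is the first nonzero asymptotic coefficient of $\mathfrak F_j$, $\mathfrak p_j$ is the monic polynomial (of degree $\mathfrak k_j$) for which $-1/\mathfrak F_j-\epsilon_j\mathfrak p_j=o(1)$ as $\lambda\widehat\to\infty$, and $\mathfrak b_j>0$ is such that $\mathfrak F_{j+1}$ is normalized. Put $\mathfrak c_j=\epsilon_j\epsilon_{j+1}\mathfrak b_j^2$; write $\mathfrak p_j(\lambda)=\lambda+\mathfrak p_0^{(j)}$ if $\mathfrak k_j=1$ and $\mathfrak p_j(\lambda)=\lambda^2+\mathfrak p_1^{(j)}\lambda+\mathfrak p_0^{(j)}$ if $\mathfrak k_j=2$. The monic generalized Jacobi matrix associated with $\mathfrak F$ is the block tridiagonal matrix with diagonal blocks $\mathfrak B_j=-\mathfrak p_0^{(j)}$ if $\mathfrak k_j=1$, $\mathfrak B_j=\begin{pmatrix}0&1\\-\mathfrak p_0^{(j)}&-\mathfrak p_1^{(j)}\end{pmatrix}$ if $\mathfrak k_j=2$, superdiagonal blocks $\mathfrak D_j$ ($\mathfrak k_j\times\mathfrak k_{j+1}$, lower-left entry $1$, other entries $0$) and subdiagonal blocks $\mathfrak C_j$ ($\mathfrak k_{j+1}\times\mathfrak k_j$, lower-left entry $\mathfrak c_j$, other entries $0$). If $\mathfrak F$ is not normalized, the matrix associated with $\mathfrak F$ is by definition the one associated with $\mathfrak F/|\mathfrak s_{\mathfrak n_1-1}|$. Block $UL$-factorization of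 $J$ with parameter $s_{-1}$: put $\widehat P_j=Q_j+s_{-1}P_j$; let $\{\mathfrak n_j\}_{j\ge1}$ be the normal indices of $(s_{-1},s_0,s_1,\dots)$, $\mathfrak n_0=0$, and $\mathfrak k_j=\mathfrak n_{j+1}-\mathfrak n_j$, $j\in\mathbb Z_+$; one has $\widehat P_{\mathfrak n_j-1}(0)\neq0$, $j\in\mathbb N$. It is the factorization $J=\mathfrak U\mathfrak L$ in which $\mathfrak L$ is block lower bidiagonal with diagonal blocks $\mathfrak E_j$ and subdiagonal blocks $\mathfrak L_j$ ($\mathfrak k_j\times\mathfrak k_{j-1}$, in block row $j$, $j\ge1$, with lower-right entry $\mathfrak l_j$ and other entries $0$), $\mathfrak U$ is block upper bidiagonal with diagonal blocks $\mathfrak U_j$ and superdiagonal blocks $\mathfrak D_j$ ($\mathfrak k_j\times\mathfrak k_{j+1}$, lower-left entry $1$, other entries $0$), where $\mathfrak U_j=\mathfrak u_j$, $\mathfrak E_j=1$ if $\mathfrak k_j=1$ and $\mathfrak U_j=\begin{pmatrix}0&1\\ \mathfrak u_j&0\end{pmatrix}$, $\mathfrak E_j=\begin{pmatrix}1&0\\ \mathfrak e_j&1\end{pmatrix}$ if $\mathfrak k_j=2$, and $\mathfrak l_j=-\widehat P_{\mathfrak n_{j+1}-1}(0)/\widehat P_{\mathfrak n_j-1}(0)$, $j\in\mathbb N$. *)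

theory Defs
  imports
    "HOL-Complex_Analysis.Complex_Analysis"
    "HOL-Library.Infinite_Set"
    "HOL-Library.Landau_Symbols"
    "Jordan_Normal_Form.Determinant"
begin

section \<open>Nevanlinna functions and the classes D-plus, D-minus\<close>

definition UHP :: "complex set" where
  "UHP = {z. 0 < Im z}"

definition sector_inf :: "real \<Rightarrow> complex filter" where
  "sector_inf \<epsilon> = inf at_infinity (principal {z. \<epsilon> < Arg z \<and> Arg z < pi - \<epsilon>})"

text \<open>The expansion f(z) ~ - sum s j / z^(j+1) is required in every sector (for
  \<^term>\<open>\<epsilon> \<ge> pi / 2\<close> the sector is empty and the condition is void).\<close>

definition asymp_expansion :: "(complex \<Rightarrow> complex) \<Rightarrow> (nat \<Rightarrow> real) \<Rightarrow> bool" where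
  "asymp_expansion f s \<longleftrightarrow>
     (\<forall>\<epsilon>>0. \<forall>n. (\<lambda>z. f z + (\<Sum>j\<le>2*n. of_real (s j) / z ^ (j + 1)))
                 \<in> o[sector_inf \<epsilon>](\<lambda>z. 1 / z ^ (2*n + 1)))"

definition nevanlinna :: "(complex \<Rightarrow> complex) set" where
  "nevanlinna = {f. f holomorphic_on UHP \<and> f ` UHP \<subseteq> UHP}"

definition N_minf :: "(complex \<Rightarrow> complex) set" where
  "N_minf = {f \<in> nevanlinna. \<exists>s. asymp_expansion f s}"

definition D_plus_minf :: "(complex \<Rightarrow> complex) set" where
  "D_plus_minf = {f. f meromorphic_on UHP \<and>
     (\<exists>s. asymp_expansion f s \<and> (\<lambda>z. z * f z + of_real (s 0)) \<in> N_minf)}"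

definition D_minus_minf :: "(complex \<Rightarrow> complex) set" where
  "D_minus_minf = {f. f meromorphic_on UHP \<and>
     (\<exists>s::real. s \<noteq> 0 \<and> (\<lambda>z. - (of_real s / z) + f z / z) \<in> N_minf)}"

text \<open>Identities between meromorphic functions are stated outside a set without limit points
  in the half-plane, since HOL functions take arbitrary values at poles.\<close>

definition rational_on_UHP :: "(complex \<Rightarrow> complex) \<Rightarrow> bool" where
  "rational_on_UHP f \<longleftrightarrow>
     (\<exists>p q :: complex poly. q \<noteq> 0 \<and> (\<forall>\<^sub>\<approx>z\<in>UHP. f z = poly p z / poly q z))"


section \<open>The Jacobi matrix and the orthogonal polynomials of a Nevanlinna function\<close>

definition represents :: "real measure \<Rightarrow> (complex \<Rightarrow> complex) \<Rightarrow> bool" where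
  "represents \<sigma> F \<longleftrightarrow>
     sets \<sigma> = sets borel \<and> finite_measure \<sigma> \<and> (\<forall>j::nat. integrable \<sigma> (\<lambda>t. t ^ j)) \<and>
     (\<forall>z\<in>UHP. F z = (\<integral>t. 1 / (of_real t - z) \<partial>\<sigma>))"

definition moment :: "real measure \<Rightarrow> nat \<Rightarrow> real" where
  "moment \<sigma> j = (\<integral>t. t ^ j \<partial>\<sigma>)"

definition monic_orthogonal :: "real measure \<Rightarrow> (nat \<Rightarrow> real poly) \<Rightarrow> bool" where
  "monic_orthogonal \<sigma> P \<longleftrightarrow>
     (\<forall>j. Polynomial.degree (P j) = j \<and> lead_coeff (P j) = 1) \<and>
     (\<forall>i j. i \<noteq> j \<longrightarrow> (\<integral>t. poly (P i) t * poly (P j) t \<partial>\<sigma>) = 0)"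

definition three_term_recurrence ::
    "(nat \<Rightarrow> real poly) \<Rightarrow> (nat \<Rightarrow> real) \<Rightarrow> (nat \<Rightarrow> real) \<Rightarrow> bool" where
  "three_term_recurrence P b c \<longleftrightarrow>
     (\<forall>j. 0 < c j) \<and>
     (\<forall>j. [:0, 1:] * P j =
        P (Suc j) + Polynomial.smult (b j) (P j) + (if j = 0 then 0 else Polynomial.smult (c (j - 1)) (P (j - 1))))"

definition monic_jacobi_matrix :: "(nat \<Rightarrow> real) \<Rightarrow> (nat \<Rightarrow> real) \<Rightarrow> nat \<Rightarrow> nat \<Rightarrow> real" where
  "monic_jacobi_matrix b c i j =
     (if j = i then b i else if j = Suc i then 1 else if i = Suc j then c j else 0)"

text \<open>\<open>P\<close> are the polynomials of the first kind and \<open>J\<close> is the monic Jacobi matrix belonging to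
  the function represented by \<open>\<sigma>\<close>. Orthogonality with respect to \<open>\<sigma>\<close> and with respect to the
  normalized measure is the same.\<close>

definition jacobi_associated ::
    "real measure \<Rightarrow> (nat \<Rightarrow> real poly) \<Rightarrow> (nat \<Rightarrow> nat \<Rightarrow> real) \<Rightarrow> bool" where
  "jacobi_associated \<sigma> P J \<longleftrightarrow>
     monic_orthogonal \<sigma> P \<and> (\<exists>b c. three_term_recurrence P b c \<and> J = monic_jacobi_matrix b c)"

text \<open>\<^term>\<open>synthetic_div p t\<close> is the quotient (p(x) - p(t)) / (x - t) as a polynomial in x, so
  the integrand has its correct value p'(t) at t = x even if \<open>\<sigma>\<close> has an atom there.\<close>

definition second_kind :: "real measure \<Rightarrow> real poly \<Rightarrow> real \<Rightarrow> real" where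
  "second_kind \<sigma> p x = (\<integral>t. poly (synthetic_div p t) x \<partial>\<sigma>)"

definition P_hat :: "real measure \<Rightarrow> (nat \<Rightarrow> real poly) \<Rightarrow> real \<Rightarrow> nat \<Rightarrow> real \<Rightarrow> real" where
  "P_hat \<sigma> P s j x = second_kind \<sigma> (P j) x + s * poly (P j) x"


section \<open>Normal indices and infinite block matrices\<close>

definition hankel_det :: "(nat \<Rightarrow> real) \<Rightarrow> nat \<Rightarrow> real" where
  "hankel_det s n = Determinant.det (Matrix.mat n n (\<lambda>(i, k). s (i + k)))"

text \<open>\<^term>\<open>normal_index s 0\<close> is 0; the listing is meaningful if there are infinitely many normal
  indices.\<close>

definition normal_index :: "(nat \<Rightarrow> real) \<Rightarrow> nat \<Rightarrow> nat" where
  "normal_index s = enumerate (insert 0 {n. 1 \<le> n \<and> hankel_det s n \<noteq> 0})"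

definition block_size :: "(nat \<Rightarrow> nat) \<Rightarrow> nat \<Rightarrow> nat" where
  "block_size n j = n (Suc j) - n j"

text \<open>Block j occupies the scalar indices n j, ..., n (j + 1) - 1. \<open>B I K\<close> is the block in block
  row I and block column K.\<close>

definition block_of :: "(nat \<Rightarrow> nat) \<Rightarrow> nat \<Rightarrow> nat" where
  "block_of n i = (LEAST j. i < n (Suc j))"

definition block_matrix :: "(nat \<Rightarrow> nat) \<Rightarrow> (nat \<Rightarrow> nat \<Rightarrow> real mat) \<Rightarrow> nat \<Rightarrow> nat \<Rightarrow> real" where
  "block_matrix n B i k =
     B (block_of n i) (block_of n k) $$ (i - n (block_of n i), k - n (block_of n k))"

definition corner_LL :: "nat \<Rightarrow> nat \<Rightarrow> real \<Rightarrow> real mat" where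
  "corner_LL r c x = Matrix.mat r c (\<lambda>(i, k). if i = r - 1 \<and> k = 0 then x else 0)"

definition corner_LR :: "nat \<Rightarrow> nat \<Rightarrow> real \<Rightarrow> real mat" where
  "corner_LR r c x = Matrix.mat r c (\<lambda>(i, k). if i = r - 1 \<and> k = c - 1 then x else 0)"

text \<open>Only used for row-finite factors, where the series has finitely many nonzero terms.\<close>

definition inf_mat_mult ::
    "(nat \<Rightarrow> nat \<Rightarrow> real) \<Rightarrow> (nat \<Rightarrow> nat \<Rightarrow> real) \<Rightarrow> nat \<Rightarrow> nat \<Rightarrow> real" where
  "inf_mat_mult A B i j = (\<Sum>k. A i k * B k j)"


section \<open>Block UL-factorization\<close>

text \<open>In this and the next section blocks have size 1 or 2, so \<open>else\<close> stands for size 2.\<close>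

definition U_diag :: "nat \<Rightarrow> real \<Rightarrow> real mat" where
  "U_diag k u = (if k = 1 then mat_of_rows_list 1 [[u]] else mat_of_rows_list 2 [[0, 1], [u, 0]])"

definition E_diag :: "nat \<Rightarrow> real \<Rightarrow> real mat" where
  "E_diag k e = (if k = 1 then mat_of_rows_list 1 [[1]] else mat_of_rows_list 2 [[1, 0], [e, 1]])"

definition U_blocks :: "(nat \<Rightarrow> nat) \<Rightarrow> (nat \<Rightarrow> real) \<Rightarrow> nat \<Rightarrow> nat \<Rightarrow> real mat" where
  "U_blocks k u i j =
     (if j = i then U_diag (k i) (u i)
      else if j = Suc i then corner_LL (k i) (k j) 1
      else 0\<^sub>m (k i) (k j))"

definition L_blocks ::
    "(nat \<Rightarrow> nat) \<Rightarrow> (nat \<Rightarrow> real) \<Rightarrow> (nat \<Rightarrow> real) \<Rightarrow> nat \<Rightarrow> nat \<Rightarrow> real mat" where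
  "L_blocks k e l i j =
     (if j = i then E_diag (k i) (e i)
      else if i = Suc j then corner_LR (k i) (k j) (l i)
      else 0\<^sub>m (k i) (k j))"

text \<open>The sequence (s, s_0, s_1, ...) is \<^term>\<open>case_nat s (moment \<sigma>)\<close>. The value of \<open>l\<close> at 0 is
  not used.\<close>

definition block_UL_factorization ::
    "real measure \<Rightarrow> (nat \<Rightarrow> real poly) \<Rightarrow> real \<Rightarrow>
     (nat \<Rightarrow> nat \<Rightarrow> real) \<Rightarrow> (nat \<Rightarrow> nat \<Rightarrow> real) \<Rightarrow> (nat \<Rightarrow> nat \<Rightarrow> real) \<Rightarrow> bool" where
  "block_UL_factorization \<sigma> P s J U L \<longleftrightarrow>
     (\<exists>u e l. let n = normal_index (case_nat s (moment \<sigma>)); k = block_size n in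
        (\<forall>j\<ge>1. l j = - (P_hat \<sigma> P s (n (j + 1) - 1) 0 / P_hat \<sigma> P s (n j - 1) 0)) \<and>
        U = block_matrix n (U_blocks k u) \<and>
        L = block_matrix n (L_blocks k e l) \<and>
        J = inf_mat_mult U L)"


section \<open>Monic generalized Jacobi matrices\<close>

definition B_diag :: "nat \<Rightarrow> real poly \<Rightarrow> real mat" where
  "B_diag k p =
     (if k = 1 then mat_of_rows_list 1 [[- Polynomial.coeff p 0]]
      else mat_of_rows_list 2 [[0, 1], [- Polynomial.coeff p 0, - Polynomial.coeff p 1]])"

definition GJM_blocks ::
    "(nat \<Rightarrow> nat) \<Rightarrow> (nat \<Rightarrow> real poly) \<Rightarrow> (nat \<Rightarrow> real) \<Rightarrow> nat \<Rightarrow> nat \<Rightarrow> real mat" where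
  "GJM_blocks k p c i j =
     (if j = i then B_diag (k i) (p i)
      else if j = Suc i then corner_LL (k i) (k j) 1
      else if i = Suc j then corner_LL (k i) (k j) (c j)
      else 0\<^sub>m (k i) (k j))"

definition first_nonzero :: "(nat \<Rightarrow> real) \<Rightarrow> real" where
  "first_nonzero s = s (LEAST j. s j \<noteq> 0)"

text \<open>\<open>\<Phi> 0 = f, \<Phi> 1, \<Phi> 2, ...\<close> are the normalized functions produced by the continued fraction
  expansion of f, with asymptotic coefficients \<open>s 0, s 1, s 2, ...\<close>. All data are uniquely
  determined by f, up to the values of \<open>\<Phi>\<close> on a set without limit points.\<close>

definition continued_fraction ::
    "(complex \<Rightarrow> complex) \<Rightarrow> (nat \<Rightarrow> complex \<Rightarrow> complex) \<Rightarrow> (nat \<Rightarrow> nat \<Rightarrow> real) \<Rightarrow>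
     (nat \<Rightarrow> real) \<Rightarrow> (nat \<Rightarrow> real poly) \<Rightarrow> (nat \<Rightarrow> real) \<Rightarrow> bool" where
  "continued_fraction f \<Phi> s \<epsilon> p b \<longleftrightarrow>
     \<Phi> 0 = f \<and>
     (\<forall>j. \<Phi> j meromorphic_on UHP \<and> asymp_expansion (\<Phi> j) (s j) \<and>
        \<epsilon> j = first_nonzero (s j) \<and> \<bar>\<epsilon> j\<bar> = 1 \<and>
        Polynomial.degree (p j) = block_size (normal_index (s 0)) j \<and> lead_coeff (p j) = 1 \<and>
        (\<forall>\<delta>>0. ((\<lambda>z. - 1 / \<Phi> j z - of_real (\<epsilon> j) * poly (map_poly of_real (p j)) z)
                 \<longlongrightarrow> 0) (sector_inf \<delta>)) \<and>
        0 < b j \<and>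
        (\<forall>\<^sub>\<approx>z\<in>UHP. - 1 / \<Phi> j z =
           of_real (\<epsilon> j) * poly (map_poly of_real (p j)) z + of_real ((b j)\<^sup>2) * \<Phi> (Suc j) z))"

definition normalized_GJM ::
    "(complex \<Rightarrow> complex) \<Rightarrow> (nat \<Rightarrow> nat \<Rightarrow> real) \<Rightarrow> bool" where
  "normalized_GJM f M \<longleftrightarrow>
     (\<exists>\<Phi> s \<epsilon> p b. continued_fraction f \<Phi> s \<epsilon> p b \<and>
        (let n = normal_index (s 0); c = (\<lambda>j. \<epsilon> j * \<epsilon> (Suc j) * (b j)\<^sup>2)
         in M = block_matrix n (GJM_blocks (block_size n) p c)))"

text \<open>For normalized \<open>f\<close> the divisor below is 1.\<close>

definition monic_GJM_of ::
    "(complex \<Rightarrow> complex) \<Rightarrow> (nat \<Rightarrow> nat \<Rightarrow> real) \<Rightarrow> bool" where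
  "monic_GJM_of f M \<longleftrightarrow>
     f \<in> D_plus_minf \<union> D_minus_minf \<and> \<not> rational_on_UHP f \<and>
     (\<exists>s. asymp_expansion f s \<and>
        normalized_GJM (\<lambda>z. f z / of_real \<bar>first_nonzero s\<bar>) M)"

end

theory Submission
  imports Defs
begin

text \<open>
Let \<open>s\<close> be the parameter, \<open>s\<^sub>j\<close> the moments of \<open>\<sigma>\<close>, and \<open>R\<close> the vector of the functions of the
second kind, whose entries are the Cauchy transforms of \<open>P\<^sub>m d\<sigma>\<close>. The three-term recurrence says
\<open>J R = z R + s\<^sub>0 e\<^sub>0\<close>, and \<open>R\<^sub>0 = F\<close>. If \<open>J = U L\<close>, put \<open>W = (L R + a) / z\<close> with a constant
vector \<open>a\<close> in block 0 such that \<open>U a = - s\<^sub>0 e\<^sub>0\<close>. Then \<open>U W = R\<close> and therefore \<open>L U W = z W - a\<close>: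
the vector \<open>W\<close> is a solution for the transformed matrix, and its first entry is
\<open>(F - s) / z\<close>. If block 0 has size 2, then \<open>s = 0\<close>; if it has size 1, the first entry of \<open>a\<close>
is \<open>- s\<^sub>0 / u\<^sub>0\<close>, and that this is \<open>- s\<close> is what the choice of \<open>l\<^sub>1\<close> achieves
(\<open>first_u\<close>).

The product \<open>L U\<close> has the shape of a generalized Jacobi matrix, with diagonal blocks that are
companion matrices of polynomials \<open>p\<^sub>j\<close> and corner entries \<open>\<kappa>\<^sub>j\<close> below the diagonal
(\<open>LU_eq_GJM\<close>). Keeping only the first entry \<open>w\<^sub>j\<close> of each block of \<open>W\<close> gives
\<open>w\<^sub>1 = p\<^sub>0 w\<^sub>0 + g\<^sub>0\<close> and \<open>w\<^sub>j\<^sub>+\<^sub>2 = p\<^sub>j\<^sub>+\<^sub>1 w\<^sub>j\<^sub>+\<^sub>1 - \<kappa>\<^sub>j w\<^sub>j\<close> (\<open>w_rec_0\<close>, \<open>w_rec_Suc\<close>), and such a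
recurrence is a continued fraction for the ratios \<open>w\<^sub>j\<^sub>+\<^sub>1 / w\<^sub>j\<close>. It is the required one as soon
as these ratios have real asymptotic expansions with leading term
\<open>\<kappa>\<^sub>j z\<^sup>-\<^sup>k\<close>, \<open>k\<close> being the size of block \<open>j + 1\<close>. Indeed \<open>R\<^sub>m\<close> has an expansion that starts at
\<open>z\<^sup>-\<^sup>(\<^sup>m\<^sup>+\<^sup>1\<^sup>)\<close> by orthogonality (\<open>cauchy_transform_expansion\<close>, \<open>cauchy_coeffs_P\<close>), so \<open>w\<^sub>j\<close>
starts at the power given by the next normal index with a coefficient \<open>- g\<^sub>j\<close>, and
\<open>g\<^sub>j\<^sub>+\<^sub>1 = \<kappa>\<^sub>j g\<^sub>j\<close> (\<open>g_Suc\<close>). Expansions are closed under division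
(\<open>has_expansion_divide\<close>).

The normal indices enter only through the values \<open>h\<^sub>m = Q\<^sub>m(0) + s P\<^sub>m(0)\<close>: the Hankel determinant
of size \<open>m + 1\<close> of \<open>s, s\<^sub>0, s\<^sub>1, \<dots>\<close> vanishes exactly if \<open>h\<^sub>m\<close> does, because a kernel vector
is a multiple of \<open>P\<^sub>m\<close> (\<open>hankel_det_eq_0_iff\<close>). As \<open>h\<close> satisfies the three-term recurrence,
it has no two consecutive zeros, and so every block has size 1 or 2.
\<close>

section \<open>Asymptotic expansions in powers of 1/z\<close>

text \<open>The coefficients of an expansion form a real formal power series in \<open>1/z\<close>. The
remainder of order \<open>m\<close> is required to be \<open>O(z\<^sup>-\<^sup>m)\<close>: for expansions of infinite
length this is the same as the little-o condition, and it is stable under the shift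
\<open>f \<mapsto> z (f - a\<^sub>0)\<close>, which removes the first coefficient. Division is proved by induction
along this shift, so that no remainder of a product of truncated series has to be estimated.\<close>

definition expansion_upto ::
    "complex filter \<Rightarrow> nat \<Rightarrow> (complex \<Rightarrow> complex) \<Rightarrow> real fps \<Rightarrow> bool" where
  "expansion_upto G m f A \<longleftrightarrow>
     (\<lambda>z. z ^ m * (f z - (\<Sum>j<m. of_real (fps_nth A j) / z ^ j))) \<in> O[G](\<lambda>_. 1)"

definition has_expansion :: "complex filter \<Rightarrow> (complex \<Rightarrow> complex) \<Rightarrow> real fps \<Rightarrow> bool" where
  "has_expansion G f A \<longleftrightarrow> (\<forall>m. expansion_upto G m f A)"

lemma eventually_nonzero:
  assumes "G \<le> at_infinity"
  shows "eventually (\<lambda>z::complex. z \<noteq> 0) G"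
  using eventually_not_equal_at_infinity[of "0::complex"] assms by (rule filter_leD[rotated])

lemma expansion_upto_cong:
  assumes "eventually (\<lambda>z. f z = g z) G"
  shows "expansion_upto G m f A \<longleftrightarrow> expansion_upto G m g A"
  unfolding expansion_upto_def
  by (rule landau_o.big.in_cong) (use assms in eventually_elim, simp)

lemma has_expansion_cong:
  assumes "eventually (\<lambda>z. f z = g z) G"
  shows "has_expansion G f A \<longleftrightarrow> has_expansion G g A"
  unfolding has_expansion_def using expansion_upto_cong[OF assms] by simp

lemma expansion_upto_0: "expansion_upto G 0 f A \<longleftrightarrow> f \<in> O[G](\<lambda>_. 1)"
  by (simp add: expansion_upto_def)

lemma expansion_upto_Suc:
  assumes "G \<le> at_infinity"
  shows "expansion_upto G (Suc m) f A \<longleftrightarrow>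
           expansion_upto G m (\<lambda>z. z * (f z - of_real (fps_nth A 0))) (fps_shift 1 A)"
  unfolding expansion_upto_def
proof (rule landau_o.big.in_cong, use eventually_nonzero[OF assms] in eventually_elim)
  fix z :: complex assume "z \<noteq> 0"
  have "(\<Sum>j<Suc m. of_real (fps_nth A j) / z ^ j)
      = of_real (fps_nth A 0) + (\<Sum>j<m. of_real (fps_nth A (Suc j)) / z ^ Suc j)"
    by (subst sum.lessThan_Suc_shift) simp
  moreover have "z * (\<Sum>j<m. of_real (fps_nth A (Suc j)) / z ^ Suc j) = (\<Sum>j<m. of_real (fps_nth A (Suc j)) / z ^ j)"
    using \<open>z \<noteq> 0\<close> by (simp add: sum_distrib_left)
  ultimately show "z ^ Suc m * (f z - (\<Sum>j<Suc m. of_real (fps_nth A j) / z ^ j)) =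
       z ^ m * (z * (f z - of_real (fps_nth A 0)) - (\<Sum>j<m. of_real (fps_nth (fps_shift 1 A) j) / z ^ j))"
    by (simp add: algebra_simps)
qed

lemma has_expansion_bounded: "has_expansion G f A \<Longrightarrow> f \<in> O[G](\<lambda>_. 1)"
  unfolding has_expansion_def by (metis expansion_upto_0)

lemma has_expansion_remainder:
  assumes "G \<le> at_infinity" "has_expansion G f A"
  shows "has_expansion G (\<lambda>z. z * (f z - of_real (fps_nth A 0))) (fps_shift 1 A)"
  using assms expansion_upto_Suc[OF assms(1)] unfolding has_expansion_def by blast

lemma expansion_upto_lincomb:
  assumes "expansion_upto G m f A" "expansion_upto G m g B"
  shows "expansion_upto G m (\<lambda>z. of_real a * f z + of_real b * g z) (fps_const a * A + fps_const b * B)"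
proof -
  have "(\<lambda>z. of_real a * (z ^ m * (f z - (\<Sum>j<m. of_real (fps_nth A j) / z ^ j)))
          + of_real b * (z ^ m * (g z - (\<Sum>j<m. of_real (fps_nth B j) / z ^ j)))) \<in> O[G](\<lambda>_. 1)"
    using assms unfolding expansion_upto_def by (intro sum_in_bigo) simp_all
  also have "(\<lambda>z. of_real a * (z ^ m * (f z - (\<Sum>j<m. of_real (fps_nth A j) / z ^ j)))
          + of_real b * (z ^ m * (g z - (\<Sum>j<m. of_real (fps_nth B j) / z ^ j)))) =
     (\<lambda>z. z ^ m * (of_real a * f z + of_real b * g z -
        (\<Sum>j<m. of_real (fps_nth (fps_const a * A + fps_const b * B) j) / z ^ j)))"
    by (simp add: algebra_simps sum.distrib sum_distrib_left add_divide_distrib)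
  finally show ?thesis unfolding expansion_upto_def .
qed

lemma has_expansion_lincomb:
  assumes "has_expansion G f A" "has_expansion G g B"
  shows "has_expansion G (\<lambda>z. of_real a * f z + of_real b * g z) (fps_const a * A + fps_const b * B)"
  using assms expansion_upto_lincomb unfolding has_expansion_def by blast

lemma fps_split: "(A :: real fps) = fps_const (fps_nth A 0) + fps_X * fps_shift 1 A"
  by (rule fps_ext) (auto simp: fps_X_mult_nth)

lemma fps_shift_X_mult: "fps_shift (Suc 0) (fps_X * A) = (A :: real fps)"
  by (rule fps_ext) simp

lemma has_expansion_tendsto:
  assumes G: "G \<le> at_infinity" and f: "has_expansion G f A"
  shows "(f \<longlongrightarrow> of_real (fps_nth A 0)) G"
proof -
  have inv: "(inverse \<longlongrightarrow> (0::complex)) G"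
    using tendsto_inverse_0 G by (rule tendsto_mono[rotated])
  have "(\<lambda>z. z * (f z - of_real (fps_nth A 0))) \<in> O[G](\<lambda>_. 1)"
    using has_expansion_bounded[OF has_expansion_remainder[OF assms]] .
  moreover have "(\<lambda>z. inverse z) \<in> o[G](\<lambda>_. 1 :: complex)"
    by (rule smalloI_tendsto) (use inv in simp_all)
  ultimately have "(\<lambda>z. z * (f z - of_real (fps_nth A 0)) * inverse z) \<in> o[G](\<lambda>_. 1 * 1)"
    by (rule landau_o.big_small_mult)
  then have "((\<lambda>z. z * (f z - of_real (fps_nth A 0)) * inverse z) \<longlongrightarrow> 0) G"
    by (auto dest: smalloD_tendsto)
  then have "((\<lambda>z. f z - of_real (fps_nth A 0)) \<longlongrightarrow> 0) G"
    by (rule Lim_transform_eventually) (use eventually_nonzero[OF G] in eventually_elim, simp)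
  then show ?thesis by (simp add: LIM_zero_iff)
qed

text \<open>If \<open>f/g\<close> has leading coefficient \<open>c\<close>, then \<open>z (f/g - c) = z (f - c g) / g\<close>, and
\<open>z (f - c g)\<close> again has an expansion that is a multiple of that of \<open>g\<close>. Hence the
shifted quotient is a quotient of the same kind, and the induction on the order of the
remainder goes through.\<close>

lemma has_expansion_divide:
  assumes G: "G \<le> at_infinity" and g: "has_expansion G g B" and B: "fps_nth B 0 \<noteq> 0"
    and f: "has_expansion G f (C * B)"
  shows "has_expansion G (\<lambda>z. f z / g z) C"
proof -
  have lim: "(g \<longlongrightarrow> of_real (fps_nth B 0)) G"
    by (rule has_expansion_tendsto[OF G g])
  have nz: "eventually (\<lambda>z. g z \<noteq> 0) G"
    using lim B by (simp add: tendsto_imp_eventually_ne)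
  have inv: "(\<lambda>z. inverse (g z)) \<in> O[G](\<lambda>_. 1)"
    by (rule bigoI_tendsto[where c = "inverse (of_real (fps_nth B 0))"])
       (use tendsto_inverse[OF lim] B in simp_all)
  have "expansion_upto G m (\<lambda>z. f z / g z) C" if "has_expansion G f (C * B)" for m f C
    using that
  proof (induction m arbitrary: f C)
    case 0
    have "(\<lambda>z. f z * inverse (g z)) \<in> O[G](\<lambda>_. 1)"
      by (rule landau_o.big.mult_in_1[OF has_expansion_bounded[OF 0] inv])
    then show ?case by (simp add: expansion_upto_0 divide_inverse)
  next
    case (Suc m)
    let ?c = "fps_nth C 0"
    have "has_expansion G (\<lambda>z. of_real 1 * f z + of_real (- ?c) * g z)
            (fps_const 1 * (C * B) + fps_const (- ?c) * B)"
      by (rule has_expansion_lincomb[OF Suc.prems g])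
    moreover have "fps_const 1 * (C * B) + fps_const (- ?c) * B = fps_X * (fps_shift 1 C * B)"
    proof -
      have "C * B = (fps_const ?c + fps_X * fps_shift 1 C) * B"
        using fps_split[of C] by simp
      then show ?thesis by (simp add: algebra_simps flip: fps_const_neg)
    qed
    ultimately have "has_expansion G (\<lambda>z. f z - of_real ?c * g z) (fps_X * (fps_shift 1 C * B))"
      by simp
    from has_expansion_remainder[OF G this]
    have "has_expansion G (\<lambda>z. z * (f z - of_real ?c * g z)) (fps_shift 1 C * B)"
      by (simp add: fps_shift_X_mult)
    from Suc.IH[OF this]
    have "expansion_upto G m (\<lambda>z. z * (f z - of_real ?c * g z) / g z) (fps_shift 1 C)" .
    also have "?this \<longleftrightarrow> expansion_upto G m (\<lambda>z. z * (f z / g z - of_real ?c)) (fps_shift 1 C)"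
      by (rule expansion_upto_cong) (use nz in eventually_elim, simp add: field_simps)
    finally show ?case by (simp add: expansion_upto_Suc[OF G])
  qed
  with f show ?thesis unfolding has_expansion_def by blast
qed

lemma has_expansion_const: "has_expansion G (\<lambda>_. of_real a) (fps_const a)"
proof -
  have "(\<Sum>j<m. of_real (fps_nth (fps_const a) j) / z ^ j) = (if m = 0 then 0 else of_real a)"
    for m and z :: complex
    by (induction m) auto
  then show ?thesis
    by (auto simp: has_expansion_def expansion_upto_def)
qed

lemma has_expansion_times_inverse:
  assumes G: "G \<le> at_infinity" and f: "has_expansion G f A"
  shows "has_expansion G (\<lambda>z. f z / z) (fps_X * A)"
  unfolding has_expansion_def
proof
  fix m
  have f0: "expansion_upto G m f A" for m using f unfolding has_expansion_def by simp
  show "expansion_upto G m (\<lambda>z. f z / z) (fps_X * A)"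
  proof (cases m)
    case 0
    have "((\<lambda>z. inverse z) \<longlongrightarrow> (0::complex)) G"
      using tendsto_inverse_0 G by (rule tendsto_mono[rotated])
    then have "(\<lambda>z. inverse z) \<in> O[G](\<lambda>_. 1 :: complex)"
      by (intro bigoI_tendsto[where c = 0]) simp_all
    from landau_o.big.mult_in_1[OF has_expansion_bounded[OF f] this] 0 show ?thesis
      by (simp add: expansion_upto_0 divide_inverse)
  next
    case (Suc k)
    have "expansion_upto G k (\<lambda>z. z * (f z / z - of_real (fps_nth (fps_X * A) 0))) A
            \<longleftrightarrow> expansion_upto G k f A"
      by (rule expansion_upto_cong) (use eventually_nonzero[OF G] in eventually_elim, simp)
    then show ?thesis using Suc f0 by (simp add: expansion_upto_Suc[OF G] fps_shift_X_mult)
  qed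
qed

lemma has_expansion_power_mult:
  assumes G: "G \<le> at_infinity" and f: "has_expansion G f A" and A: "\<And>j. j < k \<Longrightarrow> fps_nth A j = 0"
  shows "has_expansion G (\<lambda>z. z ^ k * f z) (fps_shift k A)"
  using A
proof (induction k)
  case 0 then show ?case using f by simp
next
  case (Suc k)
  have "has_expansion G (\<lambda>z. z ^ k * f z) (fps_shift k A)" by (rule Suc.IH) (use Suc.prems in simp)
  from has_expansion_remainder[OF G this] Suc.prems[of k]
  have "has_expansion G (\<lambda>z. z ^ Suc k * f z) (fps_shift 1 (fps_shift k A))"
    by (simp add: mult.assoc)
  moreover have "fps_shift 1 (fps_shift k A) = fps_shift (Suc k) A" by (rule fps_ext) simp
  ultimately show ?case by simp
qed

section \<open>Expansions in sectors\<close>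

lemma sector_inf_le: "sector_inf \<epsilon> \<le> at_infinity"
  by (simp add: sector_inf_def)

text \<open>On the sector \<open>Im z = |z| sin (Arg z) \<ge> |z| sin \<epsilon>\<close>. A Cauchy transform is
therefore bounded far out in the sector.\<close>

lemma sector_inf_Im_large:
  assumes "\<epsilon> > 0"
  shows "eventually (\<lambda>z. Im z \<ge> 1) (sector_inf \<epsilon>)"
proof (cases "\<epsilon> < pi / 2")
  case True
  have s: "sin \<epsilon> > 0" using assms True by (intro sin_gt_zero) auto
  have "eventually (\<lambda>z::complex. norm z \<ge> 1 / sin \<epsilon>) at_infinity"
    by (simp add: eventually_at_infinity) blast
  then show ?thesis unfolding sector_inf_def eventually_inf_principal
  proof (eventually_elim, intro impI)
    fix z :: complex
    assume z: "1 / sin \<epsilon> \<le> norm z" "z \<in> {z. \<epsilon> < Arg z \<and> Arg z < pi - \<epsilon>}"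
    then have nz: "z \<noteq> 0" using s by (auto simp: divide_le_0_iff)
    have "sin \<epsilon> \<le> sin (Arg z)"
    proof (cases "Arg z \<le> pi / 2")
      case True
      then show ?thesis using z assms by (intro sin_monotone_2pi_le) auto
    next
      case False
      have "sin \<epsilon> \<le> sin (pi - Arg z)"
        using z assms False \<open>\<epsilon> < pi/2\<close> by (intro sin_monotone_2pi_le) auto
      then show ?thesis by simp
    qed
    also have "sin (Arg z) = Im z / norm z"
      using nz by (simp add: sin_Arg)
    finally have "sin \<epsilon> * norm z \<le> Im z" using nz by (simp add: field_simps)
    moreover have "1 \<le> sin \<epsilon> * norm z" using z(1) s by (simp add: field_simps)
    ultimately show "Im z \<ge> 1" by linarith
  qed
next
  case False
  \<comment> \<open>The sector is empty, so its filter is trivial.\<close>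
  then have "{z. \<epsilon> < Arg z \<and> Arg z < pi - \<epsilon>} = {}" by auto
  then have "sector_inf \<epsilon> = bot" by (simp only: sector_inf_def) simp
  then show ?thesis by simp
qed

lemma sector_inf_UHP:
  assumes "\<epsilon> > 0"
  shows "eventually (\<lambda>z. z \<in> UHP) (sector_inf \<epsilon>)"
  using sector_inf_Im_large[OF assms] by eventually_elim (auto simp: UHP_def)

text \<open>The coefficient with index \<open>j\<close> of an asymptotic expansion belongs to the power
\<open>z\<^sup>-\<^sup>(\<^sup>j\<^sup>+\<^sup>1\<^sup>)\<close> and carries a minus sign, hence the shift of indices.\<close>

lemma asymp_expansionI:
  assumes "\<And>\<epsilon>. \<epsilon> > 0 \<Longrightarrow> has_expansion (sector_inf \<epsilon>) f A"
    and "fps_nth A 0 = 0" and s: "\<And>j. s j = - fps_nth A (Suc j)"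
  shows "asymp_expansion f s"
  unfolding asymp_expansion_def
proof (intro allI impI)
  fix \<epsilon> :: real and n :: nat assume "\<epsilon> > 0"
  let ?G = "sector_inf \<epsilon>"
  let ?r = "\<lambda>z. f z + (\<Sum>j\<le>2*n. of_real (s j) / z ^ (j + 1))"
  have inv: "(inverse \<longlongrightarrow> (0::complex)) ?G"
    using tendsto_inverse_0 sector_inf_le by (rule tendsto_mono[rotated])
  have "(\<Sum>j<2*n+2. of_real (fps_nth A j) / z ^ j) = - (\<Sum>j\<le>2*n. of_real (s j) / z ^ (j + 1))"
    for z :: complex
  proof -
    have "(\<Sum>j<2*n+2. of_real (fps_nth A j) / z ^ j) =
        (\<Sum>j<Suc (2*n). of_real (fps_nth A (Suc j)) / z ^ Suc j)"
      using assms(2) by (simp only: add_2_eq_Suc' sum.lessThan_Suc_shift) simp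
    then show ?thesis by (simp add: s lessThan_Suc_atMost sum_negf)
  qed
  moreover have "expansion_upto ?G (2*n+2) f A"
    using assms(1)[OF \<open>\<epsilon> > 0\<close>] unfolding has_expansion_def by blast
  ultimately have "(\<lambda>z. z ^ (2*n+2) * ?r z) \<in> O[?G](\<lambda>_. 1)"
    unfolding expansion_upto_def by simp
  moreover have "(\<lambda>z. inverse z) \<in> o[?G](\<lambda>_. 1 :: complex)"
    by (rule smalloI_tendsto) (use inv in simp_all)
  ultimately have "(\<lambda>z. (z ^ (2*n+2) * ?r z) * inverse z) \<in> o[?G](\<lambda>_. 1 * 1)"
    by (rule landau_o.big_small_mult)
  then have "(\<lambda>z. (1 / z^(2*n+1)) * ((z ^ (2*n+2) * ?r z) * inverse z)) \<in> o[?G](\<lambda>z. (1 / z^(2*n+1)) * (1 * 1))"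
    by (rule landau_o.big_small_mult[rotated]) simp
  also have "?this \<longleftrightarrow> ?r \<in> o[?G](\<lambda>z. (1 / z^(2*n+1)) * (1 * 1))"
    by (rule landau_o.small.in_cong)
       (use eventually_nonzero[OF sector_inf_le] in eventually_elim, simp add: field_simps)
  finally show "?r \<in> o[?G](\<lambda>z. 1 / z ^ (2*n + 1))" by simp
qed

section \<open>Cauchy transforms of polynomials\<close>

locale finite_moments =
  fixes \<sigma> :: "real measure"
  assumes sets_\<sigma>: "sets \<sigma> = sets borel"
    and integrable_power: "\<And>j::nat. integrable \<sigma> (\<lambda>t. t ^ j)"
begin

definition integral_poly :: "real poly \<Rightarrow> real" where
  "integral_poly p = (\<integral>t. poly p t \<partial>\<sigma>)"

definition cauchy_transform :: "real poly \<Rightarrow> complex \<Rightarrow> complex" where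
  "cauchy_transform p z = (\<integral>t. of_real (poly p t) / (of_real t - z) \<partial>\<sigma>)"

text \<open>The linear functional on polynomials whose moments are \<open>s, s\<^sub>0, s\<^sub>1, \<dots>\<close>. On the polynomials
of the first kind it takes the values \<open>Q\<^sub>j(0) + s P\<^sub>j(0)\<close> that enter the factorization.\<close>

definition shifted_functional :: "real \<Rightarrow> real poly \<Rightarrow> real" where
  "shifted_functional s p = second_kind \<sigma> p 0 + s * poly p 0"

lemma integrable_poly: "integrable \<sigma> (poly p)"
proof -
  have "integrable \<sigma> (\<lambda>t. \<Sum>i\<le>Polynomial.degree p. Polynomial.coeff p i * t ^ i)"
    by (intro Bochner_Integration.integrable_sum integrable_mult_right integrable_power)
  then show ?thesis by (simp add: poly_altdef[abs_def])
qed

lemma integral_poly_add: "integral_poly (p + q) = integral_poly p + integral_poly q"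
  by (simp add: integral_poly_def integrable_poly)

lemma integral_poly_smult: "integral_poly (Polynomial.smult a p) = a * integral_poly p"
  by (simp add: integral_poly_def)

lemma integral_poly_diff: "integral_poly (p - q) = integral_poly p - integral_poly q"
  by (simp add: integral_poly_def integrable_poly)

lemma integral_poly_monom: "integral_poly (Polynomial.monom 1 j) = moment \<sigma> j"
  by (simp add: integral_poly_def moment_def poly_monom)

lemma Im_le_norm_diff: "z \<in> UHP \<Longrightarrow> Im z \<le> norm (of_real t - z)"
  using abs_Im_le_cmod[of "of_real t - z"] by (auto simp: UHP_def)

lemma cauchy_kernel_bound:
  assumes "z \<in> UHP"
  shows "norm (of_real x / (of_real t - z) :: complex) \<le> \<bar>x\<bar> / Im z"
  using Im_le_norm_diff[OF assms, of t] assms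
  by (auto simp: norm_divide UHP_def intro!: divide_left_mono mult_pos_pos)

lemma integrable_cauchy:
  assumes "z \<in> UHP"
  shows "integrable \<sigma> (\<lambda>t. of_real (poly p t) / (of_real t - z) :: complex)"
proof (rule Bochner_Integration.integrable_bound)
  show "integrable \<sigma> (\<lambda>t. poly p t / Im z)" using integrable_poly by simp
  have "(\<lambda>t. of_real (poly p t) / (of_real t - z) :: complex) \<in> borel_measurable borel"
    by (intro borel_measurable_divide borel_measurable_of_real borel_measurable_diff
          borel_measurable_continuous_onI continuous_intros)
  then show "(\<lambda>t. of_real (poly p t) / (of_real t - z) :: complex) \<in> borel_measurable \<sigma>"
    using sets_\<sigma> by (simp cong: measurable_cong_sets)
  show "AE t in \<sigma>. norm (of_real (poly p t) / (of_real t - z) :: complex) \<le> norm (poly p t / Im z)"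
    using cauchy_kernel_bound[OF assms] assms by (auto simp: UHP_def)
qed

lemma norm_cauchy_transform_le:
  assumes "z \<in> UHP"
  shows "norm (cauchy_transform p z) \<le> (\<integral>t. \<bar>poly p t\<bar> \<partial>\<sigma>) / Im z"
proof -
  have "norm (cauchy_transform p z) \<le> (\<integral>t. norm (of_real (poly p t) / (of_real t - z) :: complex) \<partial>\<sigma>)"
    unfolding cauchy_transform_def by (rule integral_norm_bound)
  also have "\<dots> \<le> (\<integral>t. \<bar>poly p t\<bar> / Im z \<partial>\<sigma>)"
    by (rule integral_mono[OF integrable_norm[OF integrable_cauchy[OF assms]]])
       (use integrable_poly cauchy_kernel_bound[OF assms] in auto)
  finally show ?thesis by simp
qed

lemma cauchy_transform_add:
  "z \<in> UHP \<Longrightarrow> cauchy_transform (p + q) z = cauchy_transform p z + cauchy_transform q z"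
  by (simp add: cauchy_transform_def add_divide_distrib integrable_cauchy)

lemma cauchy_transform_smult:
  "cauchy_transform (Polynomial.smult a p) z = of_real a * cauchy_transform p z"
  by (simp add: cauchy_transform_def mult.assoc flip: integral_mult_right_zero times_divide_eq_right)

text \<open>From \<open>t / (t - z) = 1 + z / (t - z)\<close>. This identity yields both the recurrence of the
functions of the second kind and, read as a formula for \<open>z\<close> times the transform, the
asymptotic expansion.\<close>

lemma cauchy_transform_pCons_0:
  assumes z: "z \<in> UHP"
  shows "cauchy_transform (pCons 0 p) z = of_real (integral_poly p) + z * cauchy_transform p z"
proof -
  have "of_real (poly (pCons 0 p) t) / (of_real t - z)
      = of_real (poly p t) + z * (of_real (poly p t) / (of_real t - z))" for t
  proof -
    have "of_real t - z \<noteq> 0" using z by (auto simp: UHP_def complex_eq_iff)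
    then show ?thesis by (simp add: field_simps)
  qed
  then have "cauchy_transform (pCons 0 p) z
      = (\<integral>t. of_real (poly p t) + z * (of_real (poly p t) / (of_real t - z)) \<partial>\<sigma>)"
    by (simp add: cauchy_transform_def)
  also have "\<dots> = (\<integral>t. of_real (poly p t) \<partial>\<sigma>) + (\<integral>t. z * (of_real (poly p t) / (of_real t - z)) \<partial>\<sigma>)"
    by (intro Bochner_Integration.integral_add integrable_mult_right integrable_cauchy[OF z])
       (use integrable_poly in \<open>simp add: integrable_of_real\<close>)
  finally show ?thesis
    by (simp add: cauchy_transform_def integral_poly_def del: times_divide_eq_right)
qed

definition cauchy_coeffs :: "real poly \<Rightarrow> real fps" where
  "cauchy_coeffs p = Abs_fps (\<lambda>j. if j = 0 then 0 else - integral_poly (Polynomial.monom 1 (j - 1) * p))"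

text \<open>Multiplying the weight by \<open>t\<close> is the shift of the expansion, so it is enough that the
transform of every polynomial is bounded in the sector; this is clear from the bound by
\<open>1 / Im z\<close>.\<close>

lemma cauchy_transform_expansion:
  assumes "\<epsilon> > 0"
  shows "has_expansion (sector_inf \<epsilon>) (cauchy_transform p) (cauchy_coeffs p)"
  unfolding has_expansion_def
proof
  let ?G = "sector_inf \<epsilon>"
  have bounded: "cauchy_transform p \<in> O[?G](\<lambda>_. 1)" for p
  proof (rule bigoI[where c = "\<integral>t. \<bar>poly p t\<bar> \<partial>\<sigma>"], use sector_inf_Im_large[OF assms] in eventually_elim)
    fix z assume z: "1 \<le> Im z"
    then have "norm (cauchy_transform p z) \<le> (\<integral>t. \<bar>poly p t\<bar> \<partial>\<sigma>) / Im z"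
      by (intro norm_cauchy_transform_le) (auto simp: UHP_def)
    also have "\<dots> \<le> (\<integral>t. \<bar>poly p t\<bar> \<partial>\<sigma>) / 1"
      by (intro divide_left_mono) (use z in auto)
    finally show "norm (cauchy_transform p z) \<le> (\<integral>t. \<bar>poly p t\<bar> \<partial>\<sigma>) * norm (1::complex)" by simp
  qed
  show "expansion_upto ?G m (cauchy_transform p) (cauchy_coeffs p)" for m
  proof (induction m arbitrary: p)
    case 0 then show ?case using bounded by (simp add: expansion_upto_0)
  next
    case (Suc m)
    have "expansion_upto ?G m (\<lambda>z. of_real 1 * cauchy_transform (pCons 0 p) z + of_real (- integral_poly p) * 1)
       (fps_const 1 * cauchy_coeffs (pCons 0 p) + fps_const (- integral_poly p) * fps_const 1)"
      by (rule expansion_upto_lincomb[OF Suc])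
         (use has_expansion_const[of ?G 1] in \<open>simp add: has_expansion_def\<close>)
    also have "fps_const 1 * cauchy_coeffs (pCons 0 p) + fps_const (- integral_poly p) * fps_const 1
        = fps_shift 1 (cauchy_coeffs p)"
    proof (rule fps_ext)
      fix j
      show "fps_nth (fps_const 1 * cauchy_coeffs (pCons 0 p) + fps_const (- integral_poly p) * fps_const 1) j
        = fps_nth (fps_shift 1 (cauchy_coeffs p)) j"
        by (cases j) (simp_all add: cauchy_coeffs_def monom_Suc flip: one_pCons)
    qed
    also have "expansion_upto ?G m (\<lambda>z. of_real 1 * cauchy_transform (pCons 0 p) z + of_real (- integral_poly p) * 1)
        (fps_shift 1 (cauchy_coeffs p)) \<longleftrightarrow>
      expansion_upto ?G m (\<lambda>z. z * (cauchy_transform p z - of_real (fps_nth (cauchy_coeffs p) 0))) (fps_shift 1 (cauchy_coeffs p))"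
      by (rule expansion_upto_cong)
         (use sector_inf_UHP[OF assms] in eventually_elim, simp add: cauchy_transform_pCons_0 cauchy_coeffs_def)
    finally show ?case by (simp add: expansion_upto_Suc[OF sector_inf_le])
  qed
qed

text \<open>Dividing \<open>p(t) - p(0)\<close> by \<open>t\<close> just drops the constant coefficient, so the functional
is computed by \<open>\<sigma>\<close> on all higher coefficients.\<close>

lemma shifted_functional_pCons:
  "shifted_functional s (pCons a p) = integral_poly p + s * a"
  by (simp add: shifted_functional_def second_kind_def integral_poly_def)

lemma shifted_functional_add:
  "shifted_functional s (p + q) = shifted_functional s p + shifted_functional s q"
  by (cases p; cases q) (simp add: shifted_functional_pCons integral_poly_add algebra_simps)

lemma shifted_functional_smult:
  "shifted_functional s (Polynomial.smult a p) = a * shifted_functional s p"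
  by (cases p) (simp add: shifted_functional_pCons integral_poly_smult algebra_simps)

lemma shifted_functional_monom:
  "shifted_functional s (Polynomial.monom 1 j) = case_nat s (moment \<sigma>) j"
proof (cases j)
  case 0
  then have "Polynomial.monom (1::real) j = pCons 1 0" by (simp add: monom_0)
  then show ?thesis using 0
    by (simp only: shifted_functional_pCons) (simp add: integral_poly_def)
next
  case (Suc k)
  then show ?thesis by (simp add: monom_Suc shifted_functional_pCons integral_poly_monom)
qed

lemma shifted_functional_sum:
  fixes n :: nat
  shows "shifted_functional s (\<Sum>k<n. Polynomial.smult (x k) (p k)) = (\<Sum>k<n. x k * shifted_functional s (p k))"
proof (induction n)
  case 0
  have "shifted_functional s (pCons 0 0) = 0" by (simp only: shifted_functional_pCons) (simp add: integral_poly_def)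
  then show ?case by simp
qed (simp add: shifted_functional_add shifted_functional_smult)

end

section \<open>Orthogonal polynomials and Hankel determinants\<close>

locale jacobi_polynomials = finite_moments +
  fixes P :: "nat \<Rightarrow> real poly" and b c :: "nat \<Rightarrow> real"
  assumes mass_pos: "0 < moment \<sigma> 0"
    and orthogonal: "monic_orthogonal \<sigma> P"
    and recurrence: "three_term_recurrence P b c"
begin

lemma degree_P [simp]: "Polynomial.degree (P j) = j" and lead_coeff_P: "Polynomial.coeff (P j) j = 1"
  using orthogonal unfolding monic_orthogonal_def by auto metis

lemma c_pos: "0 < c j"
  using recurrence by (simp add: three_term_recurrence_def)

lemma P_0: "P 0 = 1"
  using degree_P[of 0] lead_coeff_P[of 0] by (metis degree_0_id one_pCons)

lemma pCons_P_0: "pCons 0 (P 0) = P 1 + Polynomial.smult (b 0) (P 0)"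
  using recurrence unfolding three_term_recurrence_def by (auto dest: spec[of _ "0::nat"])

lemma pCons_P_Suc:
  "pCons 0 (P (Suc j)) = P (Suc (Suc j)) + Polynomial.smult (b (Suc j)) (P (Suc j)) + Polynomial.smult (c j) (P j)"
  using recurrence unfolding three_term_recurrence_def by (auto dest: spec[of _ "Suc j"])

lemma integral_poly_P_mult: "i \<noteq> j \<Longrightarrow> integral_poly (P i * P j) = 0"
  using orthogonal by (simp add: monic_orthogonal_def integral_poly_def)

definition sqnorm :: "nat \<Rightarrow> real" where
  "sqnorm j = integral_poly (P j * P j)"

lemma integral_poly_mult_P:
  assumes "Polynomial.degree q < j"
  shows "integral_poly (q * P j) = 0"
  using assms
proof (induction "Polynomial.degree q" arbitrary: q rule: less_induct)
  case less
  let ?d = "Polynomial.degree q"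
  let ?r = "q - Polynomial.smult (lead_coeff q) (P ?d)"
  have "integral_poly (?r * P j) = 0"
  proof (cases "?r = 0")
    case True then show ?thesis by (simp add: integral_poly_def)
  next
    case False
    have "Polynomial.degree ?r \<le> ?d" by (intro degree_diff_le) auto
    moreover have "Polynomial.coeff ?r ?d = 0" by (simp add: lead_coeff_P)
    ultimately have "Polynomial.degree ?r < ?d"
      using False by (metis le_neq_implies_less leading_coeff_0_iff)
    then show ?thesis using less by simp
  qed
  moreover have "q * P j = ?r * P j + Polynomial.smult (lead_coeff q) (P ?d * P j)"
    by (simp add: algebra_simps)
  ultimately show ?case
    using less.prems by (simp add: integral_poly_add integral_poly_smult integral_poly_P_mult del: mult_smult_left mult_smult_right)
qed

lemma integral_poly_mult_P_degree:
  assumes "Polynomial.degree q \<le> j"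
  shows "integral_poly (q * P j) = Polynomial.coeff q j * sqnorm j"
proof -
  let ?r = "q - Polynomial.smult (Polynomial.coeff q j) (P j)"
  have "integral_poly (?r * P j) = 0"
  proof (cases "?r = 0")
    case True then show ?thesis by (simp add: integral_poly_def)
  next
    case False
    have "Polynomial.degree ?r \<le> j" by (intro degree_diff_le) (use assms in auto)
    moreover have "Polynomial.coeff ?r j = 0" by (simp add: lead_coeff_P)
    ultimately have "Polynomial.degree ?r < j"
      using False by (metis le_neq_implies_less leading_coeff_0_iff)
    then show ?thesis by (rule integral_poly_mult_P)
  qed
  moreover have "q * P j = ?r * P j + Polynomial.smult (Polynomial.coeff q j) (P j * P j)"
    by (simp add: algebra_simps)
  ultimately show ?thesis
    by (simp add: integral_poly_add integral_poly_smult sqnorm_def del: mult_smult_left mult_smult_right)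
qed

lemma sqnorm_0: "sqnorm 0 = moment \<sigma> 0"
  by (simp add: sqnorm_def P_0 integral_poly_def moment_def)

text \<open>Both sides equal the integral of \<open>t P\<^sub>j P\<^sub>j\<^sub>+\<^sub>1\<close>. In particular positivity of the \<open>c\<^sub>j\<close>
and of the total mass makes \<open>\<sigma>\<close> positive definite on all polynomials.\<close>

lemma sqnorm_Suc: "sqnorm (Suc j) = c j * sqnorm j"
proof -
  have "integral_poly (pCons 0 (P j) * P (Suc j)) = sqnorm (Suc j)"
  proof (subst integral_poly_mult_P_degree)
    show "Polynomial.degree (pCons 0 (P j)) \<le> Suc j" by (metis degree_P degree_pCons_le)
  qed (simp add: lead_coeff_P)
  moreover have "integral_poly (pCons 0 (P j) * P (Suc j)) = integral_poly (pCons 0 (P (Suc j)) * P j)"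
    by (simp add: mult.commute)
  moreover have "pCons 0 (P (Suc j)) * P j =
     P (Suc (Suc j)) * P j + Polynomial.smult (b (Suc j)) (P (Suc j) * P j) + Polynomial.smult (c j) (P j * P j)"
    by (simp only: pCons_P_Suc) (simp add: algebra_simps)
  ultimately show ?thesis
    by (simp add: integral_poly_add integral_poly_smult integral_poly_P_mult sqnorm_def
      del: mult_pCons_left mult_pCons_right)
qed

lemma sqnorm_pos: "0 < sqnorm j"
  by (induction j) (simp_all add: sqnorm_0 sqnorm_Suc mass_pos c_pos)

text \<open>After subtracting the multiple of \<open>P\<^sub>m\<close>, a nonzero rest has degree \<open>d < m\<close> and is orthogonal to
\<open>P\<^sub>d\<close>; the scalar product is its leading coefficient times a positive number.\<close>

lemma orthogonal_imp_multiple: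
  assumes deg: "Polynomial.degree p \<le> m"
    and orth: "\<And>i. i < m \<Longrightarrow> integral_poly (Polynomial.monom 1 i * p) = 0"
  shows "p = Polynomial.smult (Polynomial.coeff p m) (P m)"
proof (rule ccontr)
  assume neq: "\<not> ?thesis"
  define q where "q = p - Polynomial.smult (Polynomial.coeff p m) (P m)"
  have "q \<noteq> 0" using neq by (simp add: q_def)
  have "Polynomial.degree q \<le> m" unfolding q_def by (intro degree_diff_le) (use deg in auto)
  moreover have "Polynomial.coeff q m = 0" by (simp add: q_def lead_coeff_P)
  ultimately have d: "Polynomial.degree q < m"
    using \<open>q \<noteq> 0\<close> by (metis le_neq_implies_less leading_coeff_0_iff)
  have mono: "integral_poly (Polynomial.monom 1 i * q) = 0" if "i < m" for i
  proof -
    have "Polynomial.degree (Polynomial.monom (1::real) i) < m" using that by (simp add: degree_monom_eq)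
    from integral_poly_mult_P[OF this]
    show ?thesis using orth[OF that]
      by (simp add: q_def right_diff_distrib integral_poly_diff integral_poly_smult)
  qed
  have sum: "integral_poly (\<Sum>i\<le>n. Polynomial.monom (a i) i * q) = 0" if "n < m" for n a
    using that
  proof (induction n)
    case 0
    have "Polynomial.monom (a 0) 0 = Polynomial.smult (a 0) (Polynomial.monom 1 0)" by (simp add: monom_0)
    then show ?case using 0 mono[of 0] by (simp add: integral_poly_smult del: smult_monom)
  next
    case (Suc n)
    have "Polynomial.monom (a (Suc n)) (Suc n) = Polynomial.smult (a (Suc n)) (Polynomial.monom 1 (Suc n))"
      by (simp add: smult_monom)
    then show ?case using Suc mono[of "Suc n"]
      by (simp add: integral_poly_add integral_poly_smult del: smult_monom)
  qed
  let ?d = "Polynomial.degree q"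
  have "integral_poly (P ?d * q) = integral_poly ((\<Sum>i\<le>?d. Polynomial.monom (Polynomial.coeff (P ?d) i) i) * q)"
    using poly_as_sum_of_monoms[of "P ?d"] by simp
  also have "\<dots> = 0" using sum[OF d] by (simp add: sum_distrib_right)
  finally have "Polynomial.coeff q ?d * sqnorm ?d = 0"
    by (simp add: integral_poly_mult_P_degree mult.commute)
  with sqnorm_pos[of ?d] \<open>q \<noteq> 0\<close> show False by simp
qed

text \<open>The Hankel matrix of the moments acts on coefficient vectors by testing the polynomial
against powers of the variable.\<close>

lemma hankel_row:
  assumes "Polynomial.degree p < n"
  shows "(\<Sum>k<n. case_nat s (moment \<sigma>) (i + k) * Polynomial.coeff p k)
       = shifted_functional s (Polynomial.monom 1 i * p)"
proof -
  obtain m where n: "n = Suc m" using assms by (cases n) auto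
  have "p = (\<Sum>k\<le>m. Polynomial.monom (Polynomial.coeff p k) k)"
    using assms n by (simp add: poly_as_sum_of_monoms')
  then have "Polynomial.monom 1 i * p = Polynomial.monom 1 i * (\<Sum>k\<le>m. Polynomial.monom (Polynomial.coeff p k) k)"
    by simp
  also have "\<dots> = (\<Sum>k<n. Polynomial.smult (Polynomial.coeff p k) (Polynomial.monom 1 (i + k)))"
    by (simp add: n lessThan_Suc_atMost sum_distrib_left mult_monom smult_monom)
  finally show ?thesis
    by (simp add: shifted_functional_sum shifted_functional_monom mult.commute del: smult_monom)
qed

text \<open>A kernel vector of the Hankel matrix of size \<open>m + 1\<close> is a polynomial of degree at most \<open>m\<close>.
The rows with positive index say that it is orthogonal to all powers below \<open>m\<close> with respect
to \<open>\<sigma>\<close>, so it is a multiple of \<open>P\<^sub>m\<close>; the row with index 0 then says that the functional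
vanishes on \<open>P\<^sub>m\<close>.\<close>

lemma hankel_det_eq_0_iff:
  "hankel_det (case_nat s (moment \<sigma>)) (Suc m) = 0 \<longleftrightarrow> shifted_functional s (P m) = 0"
proof -
  let ?s = "case_nat s (moment \<sigma>)"
  let ?n = "Suc m"
  let ?H = "Matrix.mat ?n ?n (\<lambda>(i, k). ?s (i + k))"
  have prod: "(?H *\<^sub>v v) $ i = (\<Sum>k<?n. ?s (i + k) * v $ k)"
    if "v \<in> carrier_vec ?n" "i < ?n" for v i
    using that by (simp add: scalar_prod_def atLeast0LessThan)
  have det: "hankel_det ?s ?n = 0 \<longleftrightarrow> (\<exists>v. v \<in> carrier_vec ?n \<and> v \<noteq> 0\<^sub>v ?n \<and> ?H *\<^sub>v v = 0\<^sub>v ?n)"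
    unfolding hankel_det_def by (rule det_0_iff_vec_prod_zero) simp
  show ?thesis
  proof
    assume "hankel_det ?s ?n = 0"
    then obtain v where v: "v \<in> carrier_vec ?n" "v \<noteq> 0\<^sub>v ?n" "?H *\<^sub>v v = 0\<^sub>v ?n" using det by blast
    define p where "p = (\<Sum>k\<le>m. Polynomial.monom (v $ k) k)"
    have coeff: "Polynomial.coeff p k = (if k \<le> m then v $ k else 0)" for k
      by (auto simp: p_def coeff_sum if_distrib cong: if_cong)
    have deg: "Polynomial.degree p \<le> m" by (rule degree_le) (simp add: coeff)
    have zero: "shifted_functional s (Polynomial.monom 1 i * p) = 0" if "i < ?n" for i
    proof -
      have "(\<Sum>k<?n. ?s (i + k) * Polynomial.coeff p k) = (?H *\<^sub>v v) $ i"
        using v(1) that by (subst prod) (auto simp: coeff intro!: sum.cong)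
      then show ?thesis using hankel_row[of p ?n s i] deg v(3) that by simp
    qed
    have p: "p = Polynomial.smult (Polynomial.coeff p m) (P m)"
    proof (rule orthogonal_imp_multiple[OF deg])
      fix i assume "i < m"
      then show "integral_poly (Polynomial.monom 1 i * p) = 0"
        using zero[of "Suc i"] by (simp add: monom_Suc shifted_functional_pCons)
    qed
    have "p \<noteq> 0"
    proof
      assume "p = 0"
      then have "v = 0\<^sub>v ?n" using v(1) coeff by (intro eq_vecI) (auto, metis less_Suc_eq_le)
      with v(2) show False by simp
    qed
    with p have "Polynomial.coeff p m \<noteq> 0" by (metis smult_0_left)
    have "shifted_functional s p = 0" using zero[of 0] by (simp add: monom_0 flip: one_pCons)
    then have "Polynomial.coeff p m * shifted_functional s (P m) = 0"
      using p shifted_functional_smult by metis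
    with \<open>Polynomial.coeff p m \<noteq> 0\<close> show "shifted_functional s (P m) = 0" by simp
  next
    assume h: "shifted_functional s (P m) = 0"
    define v where "v = Matrix.vec ?n (\<lambda>k. Polynomial.coeff (P m) k)"
    have vc: "v \<in> carrier_vec ?n" by (simp add: v_def)
    have "v $ m = 1" by (simp add: v_def lead_coeff_P)
    then have "v \<noteq> 0\<^sub>v ?n" by auto
    moreover have "?H *\<^sub>v v = 0\<^sub>v ?n"
    proof (rule eq_vecI)
      fix i assume "i < dim_vec (0\<^sub>v ?n :: real vec)"
      then have i: "i < ?n" by simp
      have "(?H *\<^sub>v v) $ i = (\<Sum>k<?n. ?s (i + k) * Polynomial.coeff (P m) k)"
        using prod[OF vc i] by (simp add: v_def)
      also have "\<dots> = shifted_functional s (Polynomial.monom 1 i * P m)"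
        by (rule hankel_row) simp
      also have "\<dots> = 0"
      proof (cases i)
        case 0 then show ?thesis using h by (simp add: monom_0 flip: one_pCons)
      next
        case (Suc k)
        then show ?thesis using i integral_poly_mult_P[of "Polynomial.monom 1 k" m]
          by (simp add: monom_Suc shifted_functional_pCons degree_monom_eq)
      qed
      finally show "(?H *\<^sub>v v) $ i = 0\<^sub>v ?n $ i" using i by simp
    qed simp
    ultimately show "hankel_det ?s ?n = 0" using det vc by blast
  qed
qed

end

section \<open>Products of block bidiagonal matrices\<close>

locale block_partition =
  fixes n :: "nat \<Rightarrow> nat"
  assumes n_0: "n 0 = 0" and n_mono: "strict_mono n"
begin

abbreviation "k \<equiv> block_size n"

lemma n_Suc: "n (Suc j) = n j + k j"
  using n_mono by (simp add: block_size_def strict_mono_less_eq)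

lemma block_of_eqI:
  assumes "r < k j"
  shows "block_of n (n j + r) = j"
  unfolding block_of_def
proof (rule Least_equality)
  show "n j + r < n (Suc j)" using assms by (simp add: n_Suc)
  fix i assume "n j + r < n (Suc i)"
  then have "n j < n (Suc i)" by simp
  then show "j \<le> i" using n_mono by (simp add: strict_mono_less)
qed

lemma index_cases:
  obtains j r where "i = n j + r" "r < k j"
proof -
  have "i < n (Suc i)"
    using strict_mono_imp_increasing[OF n_mono, of "Suc i"] by simp
  then have ex: "\<exists>j. i < n (Suc j)" by blast
  define j where "j = (LEAST j. i < n (Suc j))"
  have 1: "i < n (Suc j)" unfolding j_def using ex by (rule LeastI_ex)
  have 2: "n j \<le> i"
  proof (cases j)
    case (Suc j')
    then have "\<not> i < n (Suc j')" unfolding j_def by (metis lessI not_less_Least)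
    then show ?thesis using Suc by simp
  qed (simp add: n_0)
  show ?thesis by (rule that[of j "i - n j"]) (use 1 2 n_Suc[of j] in auto)
qed

lemma block_matrix_entry:
  assumes "r < k I" "q < k K"
  shows "block_matrix n B (n I + r) (n K + q) = B I K $$ (r, q)"
  using assms by (simp add: block_matrix_def block_of_eqI)

lemma block_product:
  assumes r: "r < k I" and q: "q < k K" and S: "finite S"
    and zero: "\<And>M s. M \<notin> S \<Longrightarrow> s < k M \<Longrightarrow> A I M $$ (r, s) = 0"
  shows "inf_mat_mult (block_matrix n A) (block_matrix n B) (n I + r) (n K + q)
       = (\<Sum>M\<in>S. \<Sum>s<k M. A I M $$ (r, s) * B M K $$ (s, q))"
proof -
  let ?f = "\<lambda>i. block_matrix n A (n I + r) i * block_matrix n B i (n K + q)"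
  let ?N = "\<lambda>M. {n M..<n (Suc M)}"
  have "inf_mat_mult (block_matrix n A) (block_matrix n B) (n I + r) (n K + q)
      = sum ?f (\<Union>M\<in>S. ?N M)"
    unfolding inf_mat_mult_def
  proof (rule suminf_finite)
    show "finite (\<Union>M\<in>S. ?N M)" using S by simp
    fix i assume i: "i \<notin> (\<Union>M\<in>S. ?N M)"
    obtain M s where iM: "i = n M + s" "s < k M" by (rule index_cases)
    then have "M \<notin> S" using i n_Suc[of M] by auto
    then show "?f i = 0" using zero iM r by (simp add: block_matrix_entry)
  qed
  also have "\<dots> = (\<Sum>M\<in>S. sum ?f (?N M))"
  proof (rule sum.UNION_disjoint)
    show "\<forall>i\<in>S. \<forall>j\<in>S. i \<noteq> j \<longrightarrow> ?N i \<inter> ?N j = {}"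
    proof (intro ballI impI)
      fix i j :: nat assume "i \<noteq> j"
      then consider "Suc i \<le> j" | "Suc j \<le> i" by linarith
      then show "?N i \<inter> ?N j = {}"
        using n_mono by cases (auto simp: strict_mono_less_eq dest!: strict_mono_mono monoD)
    qed
  qed (use S in auto)
  also have "\<dots> = (\<Sum>M\<in>S. \<Sum>s<k M. A I M $$ (r, s) * B M K $$ (s, q))"
  proof (rule sum.cong[OF refl])
    fix M
    have "sum ?f (?N M) = (\<Sum>s<k M. ?f (n M + s))"
      using sum.shift_bounds_nat_ivl[of ?f 0 "n M" "k M"]
      by (simp add: n_Suc atLeast0LessThan add.commute)
    then show "sum ?f (?N M) = (\<Sum>s<k M. A I M $$ (r, s) * B M K $$ (s, q))"
      using r q by (simp add: block_matrix_entry)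
  qed
  finally show ?thesis .
qed

end

locale small_block_partition = block_partition +
  assumes k_small: "k j = 1 \<or> k j = 2"
begin

lemma U_diag_entry [simp]:
  "U_diag (Suc 0) x $$ (0, 0) = x"
  "U_diag 2 x $$ (0, 0) = 0" "U_diag 2 x $$ (0, Suc 0) = 1"
  "U_diag 2 x $$ (Suc 0, 0) = x" "U_diag 2 x $$ (Suc 0, Suc 0) = 0"
  by (simp_all add: U_diag_def mat_of_rows_list_def)

lemma E_diag_entry [simp]:
  "E_diag (Suc 0) x $$ (0, 0) = 1"
  "E_diag 2 x $$ (0, 0) = 1" "E_diag 2 x $$ (0, Suc 0) = 0"
  "E_diag 2 x $$ (Suc 0, 0) = x" "E_diag 2 x $$ (Suc 0, Suc 0) = 1"
  by (simp_all add: E_diag_def mat_of_rows_list_def)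

lemma B_diag_entry [simp]:
  "B_diag (Suc 0) p $$ (0, 0) = - Polynomial.coeff p 0"
  "B_diag 2 p $$ (0, 0) = 0" "B_diag 2 p $$ (0, Suc 0) = 1"
  "B_diag 2 p $$ (Suc 0, 0) = - Polynomial.coeff p 0"
  "B_diag 2 p $$ (Suc 0, Suc 0) = - Polynomial.coeff p (Suc 0)"
  by (simp_all add: B_diag_def mat_of_rows_list_def)

lemma corner_entry [simp]:
  "i < r \<Longrightarrow> j < c \<Longrightarrow> corner_LL r c x $$ (i, j) = (if i = r - 1 \<and> j = 0 then x else 0)"
  "i < r \<Longrightarrow> j < c \<Longrightarrow> corner_LR r c x $$ (i, j) = (if i = r - 1 \<and> j = c - 1 then x else 0)"
  by (simp_all add: corner_LL_def corner_LR_def)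

lemma UL_entry:
  assumes "r < k I" "q < k K"
  shows "inf_mat_mult (block_matrix n (U_blocks k u)) (block_matrix n (L_blocks k e l)) (n I + r) (n K + q)
    = (\<Sum>s<k I. U_blocks k u I I $$ (r, s) * L_blocks k e l I K $$ (s, q))
    + (\<Sum>s<k (Suc I). U_blocks k u I (Suc I) $$ (r, s) * L_blocks k e l (Suc I) K $$ (s, q))"
  using assms by (subst block_product[where S = "{I, Suc I}"]) (auto simp: U_blocks_def)

text \<open>The superdiagonal block contributes to a diagonal
entry only if the next block has size 1, since its only entry sits in the lower left corner
and that of the subdiagonal block in the lower right corner.\<close>

lemma UL_diagonal_1:
  assumes "k I = 1"
  shows "inf_mat_mult (block_matrix n (U_blocks k u)) (block_matrix n (L_blocks k e l)) (n I) (n I)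
       = u I + (if k (Suc I) = 1 then l (Suc I) else 0)"
  using UL_entry[of 0 I 0 I u e l] assms k_small[of "Suc I"]
  by (auto simp: U_blocks_def L_blocks_def numeral_2_eq_2[symmetric] lessThan_nat_numeral lessThan_Suc)

lemma UL_diagonal_2:
  assumes "k I = 2"
  shows "inf_mat_mult (block_matrix n (U_blocks k u)) (block_matrix n (L_blocks k e l)) (n I) (n I) = e I"
    and "inf_mat_mult (block_matrix n (U_blocks k u)) (block_matrix n (L_blocks k e l)) (Suc (n I)) (n I) = u I"
    and "inf_mat_mult (block_matrix n (U_blocks k u)) (block_matrix n (L_blocks k e l)) (Suc (n I)) (Suc (n I))
       = (if k (Suc I) = 1 then l (Suc I) else 0)"
  using UL_entry[of 0 I 0 I u e l] UL_entry[of 1 I 0 I u e l] UL_entry[of 1 I 1 I u e l]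
    assms k_small[of "Suc I"]
  by (auto simp: U_blocks_def L_blocks_def lessThan_nat_numeral lessThan_Suc)

lemma UL_subdiagonal:
  shows "inf_mat_mult (block_matrix n (U_blocks k u)) (block_matrix n (L_blocks k e l))
       (n (Suc I)) (n (Suc I) - 1) = (if k (Suc I) = 1 then u (Suc I) * l (Suc I) else l (Suc I))"
proof -
  have "n (Suc I) - 1 = n I + (k I - 1)" "0 < k I" using n_Suc[of I] k_small[of I] by auto
  then show ?thesis
    using UL_entry[of 0 "Suc I" "k I - 1" I u e l] k_small[of "Suc I"] k_small[of "Suc (Suc I)"]
    by (auto simp: U_blocks_def L_blocks_def lessThan_nat_numeral lessThan_Suc)
qed

lemma LU_entry:
  assumes "r < k I" "q < k K"
  shows "inf_mat_mult (block_matrix n (L_blocks k e l)) (block_matrix n (U_blocks k u)) (n I + r) (n K + q)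
    = (\<Sum>s<k I. L_blocks k e l I I $$ (r, s) * U_blocks k u I K $$ (s, q))
    + (if I = 0 then 0 else
       \<Sum>s<k (I - 1). L_blocks k e l I (I - 1) $$ (r, s) * U_blocks k u (I - 1) K $$ (s, q))"
proof (cases I)
  case 0
  then show ?thesis
    using assms by (subst block_product[where S = "{I}"]) (auto simp: L_blocks_def)
next
  case (Suc I')
  then show ?thesis
    using assms by (subst block_product[where S = "{I, I'}"]) (auto simp: L_blocks_def)
qed

text \<open>The diagonal blocks of the product in the other order are companion matrices; these are
their characteristic polynomials. Block row 0 has no block of \<open>L\<close> to its left, so the value of
\<open>l\<close> at 0 must not enter.\<close>

definition LU_poly :: "(nat \<Rightarrow> real) \<Rightarrow> (nat \<Rightarrow> real) \<Rightarrow> (nat \<Rightarrow> real) \<Rightarrow> nat \<Rightarrow> real poly" where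
  "LU_poly u e l j = (let a = u j + (if j = 0 then 0 else l j) in
     if k j = 1 then [:- a, 1:] else [:- a, - e j, 1:])"

lemma LU_eq_GJM:
  "inf_mat_mult (block_matrix n (L_blocks k e l)) (block_matrix n (U_blocks k u))
   = block_matrix n (GJM_blocks k (LU_poly u e l) (\<lambda>j. l (Suc j) * u j))"
proof (intro ext)
  fix i m
  obtain I r where i: "i = n I + r" "r < k I" by (rule index_cases)
  obtain K q where m: "m = n K + q" "q < k K" by (rule index_cases)
  have "inf_mat_mult (block_matrix n (L_blocks k e l)) (block_matrix n (U_blocks k u)) (n I + r) (n K + q)
      = GJM_blocks k (LU_poly u e l) (\<lambda>j. l (Suc j) * u j) I K $$ (r, q)"
  proof (cases I)
    case 0
    show ?thesis unfolding LU_entry[OF i(2) m(2)]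
      using 0 i(2) m(2) k_small[of I] k_small[of K]
      by (auto simp: U_blocks_def L_blocks_def GJM_blocks_def LU_poly_def less_2_cases_iff
        lessThan_nat_numeral lessThan_Suc)
  next
    case (Suc I')
    consider "K = I'" | "K = I" | "K = Suc I" | "K \<noteq> I'" "K \<noteq> I" "K \<noteq> Suc I" by blast
    then show ?thesis unfolding LU_entry[OF i(2) m(2)]
      using Suc i(2) m(2) k_small[of I] k_small[of K] k_small[of I']
      by cases (auto simp: U_blocks_def L_blocks_def GJM_blocks_def LU_poly_def less_2_cases_iff
        lessThan_nat_numeral lessThan_Suc)
  qed
  then show "inf_mat_mult (block_matrix n (L_blocks k e l)) (block_matrix n (U_blocks k u)) i m
      = block_matrix n (GJM_blocks k (LU_poly u e l) (\<lambda>j. l (Suc j) * u j)) i m"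
    using i m by (simp add: block_matrix_entry)
qed

end

section \<open>Normal indices of the extended moment sequence\<close>

locale shifted_moments = jacobi_polynomials +
  fixes s :: real
begin

abbreviation N :: "nat \<Rightarrow> nat" where
  "N \<equiv> normal_index (case_nat s (moment \<sigma>))"

text \<open>These are the values \<open>Q\<^sub>m(0) + s P\<^sub>m(0)\<close>.\<close>

definition h :: "nat \<Rightarrow> real" where
  "h m = shifted_functional s (P m)"

lemma h_0: "h 0 = s"
  unfolding h_def P_0 one_pCons shifted_functional_pCons by (simp add: integral_poly_def)

lemma integral_poly_P: "integral_poly (P 0) = moment \<sigma> 0" "integral_poly (P (Suc m)) = 0"
  using integral_poly_P_mult[of 0 "Suc m"] by (simp_all add: P_0 integral_poly_def moment_def)

lemma h_1: "h 1 = moment \<sigma> 0 - b 0 * s"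
  using arg_cong[OF pCons_P_0, of "shifted_functional s"] h_0
  by (simp add: shifted_functional_pCons shifted_functional_add shifted_functional_smult
      integral_poly_P h_def)

lemma h_Suc_Suc: "h (Suc (Suc m)) = - b (Suc m) * h (Suc m) - c m * h m"
  using arg_cong[OF pCons_P_Suc, of "shifted_functional s" m]
  by (simp add: shifted_functional_pCons shifted_functional_add shifted_functional_smult
      integral_poly_P h_def)

text \<open>Two consecutive zeros would propagate down the three-term recurrence to the first two values,
where they contradict \<open>s\<^sub>0 > 0\<close>. This is why all blocks have size 1 or 2.\<close>

lemma h_no_consecutive_zeros: "h m \<noteq> 0 \<or> h (Suc m) \<noteq> 0"
proof (induction m)
  case 0 then show ?case using h_0 h_1 mass_pos by auto
next
  case (Suc m)
  then show ?case using c_pos[of m] by (auto simp: h_Suc_Suc)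
qed

lemma normal_index_set:
  "insert 0 {n. 1 \<le> n \<and> hankel_det (case_nat s (moment \<sigma>)) n \<noteq> 0} = insert 0 {Suc m | m. h m \<noteq> 0}"
proof -
  have "1 \<le> n \<and> hankel_det (case_nat s (moment \<sigma>)) n \<noteq> 0 \<longleftrightarrow> (\<exists>m. n = Suc m \<and> h m \<noteq> 0)" for n
    by (cases n) (auto simp: hankel_det_eq_0_iff h_def)
  then show ?thesis by auto
qed

lemma N_def: "N = enumerate (insert 0 {Suc m | m. h m \<noteq> 0})"
  unfolding normal_index_def normal_index_set ..

lemma infinite_normal: "infinite (insert 0 {Suc m | m. h m \<noteq> 0})"
  unfolding infinite_nat_iff_unbounded
proof
  fix m
  show "\<exists>n>m. n \<in> insert 0 {Suc m |m. h m \<noteq> 0}"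
    using h_no_consecutive_zeros[of m] by (auto intro: exI[of _ "Suc m"] exI[of _ "Suc (Suc m)"])
qed

lemma N_Suc: "N (Suc j) = (LEAST i. i \<in> insert 0 {Suc m | m. h m \<noteq> 0} \<and> N j < i)"
  unfolding N_def by (rule enumerate_Suc''[OF infinite_normal])

lemma N_Suc_cases:
  "(h (N j) \<noteq> 0 \<and> N (Suc j) = N j + 1) \<or> (h (N j) = 0 \<and> h (N j + 1) \<noteq> 0 \<and> N (Suc j) = N j + 2)"
proof (cases "h (N j) = 0")
  case False
  then have "N (Suc j) = N j + 1"
    unfolding N_Suc by (intro Least_equality) auto
  then show ?thesis using False by simp
next
  case True
  then have h1: "h (N j + 1) \<noteq> 0" using h_no_consecutive_zeros[of "N j"] by simp
  have "N (Suc j) = N j + 2"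
    unfolding N_Suc
  proof (rule Least_equality)
    fix i assume i: "i \<in> insert 0 {Suc m | m. h m \<noteq> 0} \<and> N j < i"
    then have "i \<noteq> Suc (N j)" using True by auto
    then show "N j + 2 \<le> i" using i by linarith
  qed (use h1 in auto)
  then show ?thesis using True h1 by simp
qed

lemma N_0: "N 0 = 0"
  unfolding N_def enumerate_0 by (rule Least_equality) auto

sublocale small_block_partition N
proof
  show "N 0 = 0" by (rule N_0)
  show "strict_mono N" unfolding N_def by (rule strict_mono_enumerate[OF infinite_normal])
  show "block_size N j = 1 \<or> block_size N j = 2" for j
    using N_Suc_cases[of j] by (auto simp: block_size_def)
qed

lemma k_eq_1_iff: "k j = 1 \<longleftrightarrow> h (N j) \<noteq> 0"
  using N_Suc_cases[of j] by (auto simp: block_size_def)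

lemma first_block: "k 0 = 1 \<longleftrightarrow> s \<noteq> 0"
  using k_eq_1_iff[of 0] by (simp add: N_0 h_0)

text \<open>The functions of the second kind. As a vector, \<open>R\<close> satisfies \<open>J R = z R + s\<^sub>0 e\<^sub>0\<close>.\<close>

abbreviation R :: "nat \<Rightarrow> complex \<Rightarrow> complex" where
  "R m \<equiv> cauchy_transform (P m)"

lemma R_0_rec:
  "z \<in> UHP \<Longrightarrow> z * R 0 z = R 1 z + of_real (b 0) * R 0 z - of_real (moment \<sigma> 0)"
  using cauchy_transform_pCons_0[of z "P 0"] unfolding pCons_P_0
  by (simp add: cauchy_transform_add cauchy_transform_smult integral_poly_P algebra_simps)

lemma R_Suc_rec:
  "z \<in> UHP \<Longrightarrow>
     z * R (Suc m) z = R (Suc (Suc m)) z + of_real (b (Suc m)) * R (Suc m) z + of_real (c m) * R m z"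
  using cauchy_transform_pCons_0[of z "P (Suc m)"] unfolding pCons_P_Suc
  by (simp add: cauchy_transform_add cauchy_transform_smult integral_poly_P)

text \<open>Orthogonality makes \<open>R\<^sub>m\<close> vanish at infinity to the order \<open>m + 1\<close>.\<close>

lemma cauchy_coeffs_P:
  "i \<le> m \<Longrightarrow> fps_nth (cauchy_coeffs (P m)) i = 0"
  "fps_nth (cauchy_coeffs (P m)) (Suc m) = - sqnorm m"
proof -
  show "fps_nth (cauchy_coeffs (P m)) i = 0" if "i \<le> m"
    using that integral_poly_mult_P[of "Polynomial.monom 1 (i - 1)" m]
    by (cases i) (auto simp: cauchy_coeffs_def degree_monom_eq)
  show "fps_nth (cauchy_coeffs (P m)) (Suc m) = - sqnorm m"
    using integral_poly_mult_P_degree[of "Polynomial.monom 1 m" m]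
    by (simp add: cauchy_coeffs_def degree_monom_eq)
qed

end

section \<open>The transformed functions of the second kind\<close>

locale UL_factorization = shifted_moments +
  fixes u e l :: "nat \<Rightarrow> real"
  assumes l_eq: "1 \<le> j \<Longrightarrow> l j = - (h (N (Suc j) - 1) / h (N j - 1))"
    and J_eq_UL: "monic_jacobi_matrix b c =
      inf_mat_mult (block_matrix N (U_blocks k u)) (block_matrix N (L_blocks k e l))"
begin

lemma block_1: "k j = 1 \<Longrightarrow> b (N j) = u j + (if k (Suc j) = 1 then l (Suc j) else 0)"
  using UL_diagonal_1[of j u e l] by (simp add: monic_jacobi_matrix_def flip: J_eq_UL)

lemma block_2:
  assumes "k j = 2"
  shows "b (N j) = e j" "c (N j) = u j" "b (Suc (N j)) = (if k (Suc j) = 1 then l (Suc j) else 0)"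
  using UL_diagonal_2[OF assms, of u e l] by (simp_all add: monic_jacobi_matrix_def flip: J_eq_UL)

lemma N_Suc_pos: "0 < N (Suc j)"
  using N_Suc_cases[of j] by auto

lemma block_boundary:
  "c (N (Suc j) - 1) = (if k (Suc j) = 1 then u (Suc j) * l (Suc j) else l (Suc j))"
proof -
  obtain m where "N (Suc j) = Suc m" using N_Suc_pos[of j] by (cases "N (Suc j)") auto
  then show ?thesis
    using UL_subdiagonal[of u e l j] by (simp add: monic_jacobi_matrix_def flip: J_eq_UL)
qed

text \<open>If the first two blocks have size 1, the identity \<open>J = U L\<close> prescribes only the sum of
\<open>u\<^sub>0\<close> and \<open>l\<^sub>1\<close>, and the value of \<open>l\<^sub>1\<close> singles out the factorization that belongs to
\<open>s\<close>. If the second block has size 2, then \<open>u\<^sub>0 = b\<^sub>0\<close>, and \<open>s\<close> is tied to \<open>b\<^sub>0\<close>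
by \<open>h\<^sub>1 = 0\<close>.\<close>

lemma first_u: "k 0 = 1 \<Longrightarrow> u 0 * s = moment \<sigma> 0"
proof -
  assume k0: "k 0 = 1"
  then have s: "s \<noteq> 0" using first_block by blast
  have N1: "N (Suc 0) = 1" using n_Suc[of 0] k0 N_0 by simp
  have b0: "b 0 = u 0 + (if k (Suc 0) = 1 then l (Suc 0) else 0)"
    using block_1[OF k0] by (simp add: N_0)
  show ?thesis
  proof (cases "k (Suc 0) = 1")
    case True
    then have "N (Suc (Suc 0)) = 2" using n_Suc[of "Suc 0"] N1 by simp
    then have "l (Suc 0) = - (h 1 / s)" using l_eq[of 1] N1 by (simp add: h_0)
    then show ?thesis using b0 True h_1 s by (simp add: field_simps)
  next
    case False
    then have "h 1 = 0" using k_eq_1_iff[of "Suc 0"] N1 by simp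
    then show ?thesis using b0 False h_1 by simp
  qed
qed

text \<open>The leading coefficient of \<open>- w\<^sub>j\<close> for the functions \<open>w\<^sub>j\<close> below, at the power
\<open>z\<^sup>-\<^sup>n\<close> where \<open>n\<close> is the normal index with number \<open>j + 1\<close>.\<close>

definition g :: "nat \<Rightarrow> real" where
  "g j = (if k j = 2 then sqnorm (N j) else if j = 0 then s else l j * sqnorm (N j - 1))"

text \<open>The corner entries of the subdiagonal blocks of \<open>L U\<close>.\<close>

definition \<kappa> :: "nat \<Rightarrow> real" where
  "\<kappa> j = l (Suc j) * u j"

lemma u_times_g: "u j * g j = sqnorm (N (Suc j) - 1)"
proof (cases "k j = 2")
  case True
  then show ?thesis using block_2(2)[OF True] n_Suc[of j] by (simp add: g_def sqnorm_Suc)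
next
  case False
  then have k1: "k j = 1" using k_small[of j] by simp
  show ?thesis
  proof (cases j)
    case 0
    then show ?thesis using first_u k1 n_Suc[of 0] N_0 by (simp add: g_def sqnorm_0)
  next
    case (Suc i)
    have "sqnorm (N j) = c (N j - 1) * sqnorm (N j - 1)"
      using sqnorm_Suc[of "N j - 1"] N_Suc_pos[of i] Suc by simp
    then show ?thesis using block_boundary[of i] k1 n_Suc[of j] Suc by (simp add: g_def)
  qed
qed

text \<open>Both cases of the block size reduce to the previous identity, because the entry of \<open>J\<close> at the
boundary of two blocks is one step of the recurrence of the norms.\<close>

lemma g_Suc: "g (Suc j) = \<kappa> j * g j"
proof -
  have "sqnorm (N (Suc j)) = c (N (Suc j) - 1) * sqnorm (N (Suc j) - 1)"
    using sqnorm_Suc[of "N (Suc j) - 1"] N_Suc_pos[of j] by simp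
  then have "g (Suc j) = l (Suc j) * sqnorm (N (Suc j) - 1)"
    using block_boundary[of j] by (simp add: g_def)
  then show ?thesis by (simp add: \<kappa>_def u_times_g mult.assoc)
qed

lemma g_nonzero: "g j \<noteq> 0"
proof -
  have "u j * g j \<noteq> 0" using sqnorm_pos[of "N (Suc j) - 1"] by (simp add: u_times_g)
  then show ?thesis by simp
qed

lemma \<kappa>_nonzero: "\<kappa> j \<noteq> 0"
  using g_Suc[of j] g_nonzero[of "Suc j"] by auto

text \<open>The first entries, block by block, of the vector \<open>W = (L R + a) / z\<close>. The constant vector \<open>a\<close> is
supported in block 0 and cancels the inhomogeneity of \<open>J R = z R + s\<^sub>0 e\<^sub>0\<close>; its first
entry is \<open>- s\<close>, which is zero if block 0 has size 2.\<close>

definition w :: "nat \<Rightarrow> complex \<Rightarrow> complex" where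
  "w j z = (if k j = 2 then R (N j) z
     else if j = 0 then R 0 z - of_real s
     else R (N j) z + of_real (l j) * R (N j - 1) z) / z"

lemma UHP_nonzero: "z \<in> UHP \<Longrightarrow> z \<noteq> 0"
  by (auto simp: UHP_def)

lemma times_w_Suc:
  assumes "z \<in> UHP"
  shows "z * w (Suc j) z = R (N (Suc j)) z
     + (if k (Suc j) = 1 then of_real (l (Suc j)) * R (N (Suc j) - 1) z else 0)"
  using k_small[of "Suc j"] UHP_nonzero[OF assms] by (auto simp: w_def)

text \<open>This is the last row of each block of \<open>U W = R\<close>. It is checked after multiplication by \<open>z\<close>, when it
becomes a row of \<open>J R - s\<^sub>0 e\<^sub>0 = z R\<close>.\<close>

lemma U_times_w:
  assumes z: "z \<in> UHP"
  shows "of_real (u j) * w j z + w (Suc j) z = R (N (Suc j) - 1) z"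
proof -
  have "z * (of_real (u j) * w j z + w (Suc j) z) = z * R (N (Suc j) - 1) z"
  proof (cases "k j = 2")
    case True
    then have "z * w j z = R (N j) z" using UHP_nonzero[OF z] by (simp add: w_def)
    moreover have "N (Suc j) = Suc (Suc (N j))" using True n_Suc[of j] by simp
    ultimately show ?thesis
      using R_Suc_rec[OF z, of "N j"] block_2[OF True] times_w_Suc[OF z, of j]
      by (auto simp: algebra_simps)
  next
    case False
    then have k1: "k j = 1" using k_small[of j] by simp
    then have NS: "N (Suc j) = Suc (N j)" using n_Suc[of j] by simp
    show ?thesis
    proof (cases j)
      case 0
      have "z * w 0 z = R 0 z - of_real s" using k1 0 UHP_nonzero[OF z] by (simp add: w_def)
      moreover have "of_real (u 0) * of_real s = (of_real (moment \<sigma> 0) :: complex)"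
        using first_u k1 0 by (simp flip: of_real_mult)
      ultimately have "of_real (u 0) * (z * w 0 z) = of_real (u 0) * R 0 z - of_real (moment \<sigma> 0)"
        by (simp add: right_diff_distrib)
      then have "z * (of_real (u 0) * w 0 z + w (Suc 0) z)
          = of_real (u 0) * R 0 z - of_real (moment \<sigma> 0) + z * w (Suc 0) z"
        by (simp add: algebra_simps)
      also have "\<dots> = z * R 0 z"
        unfolding R_0_rec[OF z] times_w_Suc[OF z, of 0]
        using block_1[OF k1] NS 0 N_0 by (simp add: algebra_simps)
      finally show ?thesis using NS 0 N_0 by simp
    next
      case (Suc i)
      obtain m where m: "N j = Suc m" using N_Suc_pos[of i] Suc by (cases "N j") auto
      have "c m = u j * l j" using block_boundary[of i] k1 Suc m by simp
      then have "of_real (u j) * (z * w j z) = of_real (u j) * R (N j) z + of_real (c m) * R m z"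
        using times_w_Suc[OF z, of i] k1 Suc m by (simp add: algebra_simps)
      then have "z * (of_real (u j) * w j z + w (Suc j) z)
          = of_real (u j) * R (N j) z + of_real (c m) * R m z + z * w (Suc j) z"
        by (simp add: algebra_simps)
      also have "\<dots> = z * R (N j) z"
        unfolding m R_Suc_rec[OF z, of m] times_w_Suc[OF z, of j]
        using block_1[OF k1] NS m by (simp add: algebra_simps)
      finally show ?thesis using NS by simp
    qed
  qed
  then show ?thesis using UHP_nonzero[OF z] by simp
qed

abbreviation p :: "nat \<Rightarrow> real poly" where "p \<equiv> LU_poly u e l"

lemma poly_p:
  "poly (map_poly of_real (p j)) (z::complex) =
     (let a = of_real (u j) + (if j = 0 then 0 else of_real (l j)) in
      if k j = 1 then z - a else z\<^sup>2 - of_real (e j) * z - a)"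
  by (simp add: LU_poly_def Let_def map_poly_pCons power2_eq_square algebra_simps)

text \<open>The first block row of \<open>L U W = z W - a\<close>, with the second entry eliminated if the block has size 2.
The inhomogeneity is the constant \<open>g\<^sub>0\<close>.\<close>

lemma w_rec_0:
  assumes z: "z \<in> UHP"
  shows "w (Suc 0) z = poly (map_poly of_real (p 0)) z * w 0 z + of_real (g 0)"
proof (cases "k 0 = 2")
  case True
  have w0: "z * w 0 z = R 0 z" using True UHP_nonzero[OF z] by (simp add: w_def N_0)
  have "w (Suc 0) z = R 1 z - of_real (u 0) * w 0 z"
    using U_times_w[OF z, of 0] True n_Suc[of 0] N_0 by (simp add: algebra_simps)
  also have "R 1 z = z * (z * w 0 z) - of_real (e 0) * (z * w 0 z) + of_real (moment \<sigma> 0)"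
    using R_0_rec[OF z] block_2(1)[OF True] by (simp add: w0 N_0 algebra_simps)
  finally show ?thesis
    using True by (simp add: poly_p Let_def g_def N_0 sqnorm_0 power2_eq_square algebra_simps)
next
  case False
  then have k1: "k 0 = 1" using k_small[of 0] by simp
  have w0: "z * w 0 z = R 0 z - of_real s" using k1 UHP_nonzero[OF z] by (simp add: w_def)
  have "of_real (u 0) * w 0 z + w (Suc 0) z = R 0 z"
    using U_times_w[OF z, of 0] n_Suc[of 0] k1 N_0 by simp
  then show ?thesis using w0 k1 by (simp add: poly_p Let_def g_def algebra_simps)
qed

text \<open>The remaining block rows of \<open>L U W = z W\<close>: insert the rows of \<open>U W = R\<close> into \<open>z W = L R\<close>.
Eliminating the second entry of a block of size 2 turns the companion matrix into its
characteristic polynomial.\<close>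

lemma w_rec_Suc:
  assumes z: "z \<in> UHP"
  shows "w (Suc (Suc j)) z =
    poly (map_poly of_real (p (Suc j))) z * w (Suc j) z - of_real (\<kappa> j) * w j z"
proof -
  have U0: "R (N (Suc j) - 1) z = of_real (u j) * w j z + w (Suc j) z"
    using U_times_w[OF z, of j] by simp
  have U1: "w (Suc (Suc j)) z = R (N (Suc (Suc j)) - 1) z - of_real (u (Suc j)) * w (Suc j) z"
    using U_times_w[OF z, of "Suc j"] by (simp add: algebra_simps)
  obtain m where m: "N (Suc j) = Suc m" using N_Suc_pos[of j] by (cases "N (Suc j)") auto
  show ?thesis
  proof (cases "k (Suc j) = 2")
    case True
    then have wz: "R (N (Suc j)) z = z * w (Suc j) z" using times_w_Suc[OF z, of j] by simp
    have "c m = l (Suc j)" using block_boundary[of j] True m by simp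
    then have RR: "R (Suc (Suc m)) z = z * (z * w (Suc j) z) - of_real (e (Suc j)) * (z * w (Suc j) z)
        - of_real (l (Suc j)) * (of_real (u j) * w j z + w (Suc j) z)"
      using R_Suc_rec[OF z, of m] wz U0 block_2(1)[OF True] m by (simp add: algebra_simps)
    have "N (Suc (Suc j)) - 1 = Suc (Suc m)" using n_Suc[of "Suc j"] True m by simp
    then show ?thesis
      unfolding U1 using True by (simp add: RR) (simp add: poly_p Let_def \<kappa>_def power2_eq_square algebra_simps)
  next
    case False
    then have k1: "k (Suc j) = 1" using k_small[of "Suc j"] by simp
    then have "R (N (Suc j)) z = z * w (Suc j) z - of_real (l (Suc j)) * (of_real (u j) * w j z + w (Suc j) z)"
      using times_w_Suc[OF z, of j] U0 by (simp add: algebra_simps)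
    moreover have "N (Suc (Suc j)) - 1 = N (Suc j)" using n_Suc[of "Suc j"] k1 by simp
    ultimately show ?thesis
      unfolding U1 using k1 by (simp add: poly_p Let_def \<kappa>_def algebra_simps)
  qed
qed

definition w_coeffs :: "nat \<Rightarrow> real fps" where
  "w_coeffs j = fps_X * (if k j = 2 then cauchy_coeffs (P (N j))
     else if j = 0 then cauchy_coeffs (P 0) - fps_const s
     else cauchy_coeffs (P (N j)) + fps_const (l j) * cauchy_coeffs (P (N j - 1)))"

lemma w_expansion:
  assumes "\<epsilon> > 0"
  shows "has_expansion (sector_inf \<epsilon>) (w j) (w_coeffs j)"
proof -
  let ?G = "sector_inf \<epsilon>"
  note R = cauchy_transform_expansion[OF assms]
  have "has_expansion ?G (\<lambda>z. R 0 z - of_real s) (cauchy_coeffs (P 0) - fps_const s)"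
    using has_expansion_lincomb[OF R has_expansion_const[of ?G s], of 1 "P 0" "-1"]
    by (simp flip: fps_const_neg)
  moreover have "has_expansion ?G (\<lambda>z. R (N j) z + of_real (l j) * R (N j - 1) z)
      (cauchy_coeffs (P (N j)) + fps_const (l j) * cauchy_coeffs (P (N j - 1)))"
    using has_expansion_lincomb[OF R R, of 1 "P (N j)" "l j" "P (N j - 1)"] by simp
  ultimately have "has_expansion ?G (\<lambda>z. if k j = 2 then R (N j) z
     else if j = 0 then R 0 z - of_real s
     else R (N j) z + of_real (l j) * R (N j - 1) z)
     (if k j = 2 then cauchy_coeffs (P (N j))
     else if j = 0 then cauchy_coeffs (P 0) - fps_const s
     else cauchy_coeffs (P (N j)) + fps_const (l j) * cauchy_coeffs (P (N j - 1)))"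
    using R by auto
  from has_expansion_times_inverse[OF sector_inf_le this]
  show ?thesis by (simp add: w_def[abs_def] w_coeffs_def)
qed

lemma w_coeffs_leading:
  "i < N (Suc j) \<Longrightarrow> fps_nth (w_coeffs j) i = 0"
  "fps_nth (w_coeffs j) (N (Suc j)) = - g j"
proof -
  have "(i < N (Suc j) \<longrightarrow> fps_nth (w_coeffs j) i = 0) \<and> fps_nth (w_coeffs j) (N (Suc j)) = - g j"
  proof (cases "k j = 2")
    case True
    then have "N (Suc j) = Suc (Suc (N j))" using n_Suc[of j] by simp
    then show ?thesis
      using True by (auto simp: w_coeffs_def g_def fps_X_mult_nth cauchy_coeffs_P)
  next
    case False
    then have k1: "k j = 1" using k_small[of j] by simp
    then have NS: "N (Suc j) = Suc (N j)" using n_Suc[of j] by simp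
    show ?thesis
    proof (cases j)
      case 0
      then show ?thesis using NS k1 N_0
        by (auto simp: w_coeffs_def g_def cauchy_coeffs_P)
    next
      case (Suc j')
      obtain m where m: "N j = Suc m" using N_Suc_pos[of j'] Suc by (cases "N j") auto
      show ?thesis using NS k1 Suc m
        by (auto simp: w_coeffs_def g_def fps_X_mult_nth cauchy_coeffs_P)
    qed
  qed
  then show "i < N (Suc j) \<Longrightarrow> fps_nth (w_coeffs j) i = 0"
    "fps_nth (w_coeffs j) (N (Suc j)) = - g j" by auto
qed

lemma scaled_w_expansion:
  assumes "\<epsilon> > 0"
  shows "has_expansion (sector_inf \<epsilon>) (\<lambda>z. z ^ N (Suc j) * w j z) (fps_shift (N (Suc j)) (w_coeffs j))"
    and "fps_nth (fps_shift (N (Suc j)) (w_coeffs j)) 0 = - g j"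
  using has_expansion_power_mult[OF sector_inf_le w_expansion[OF assms], of "N (Suc j)"] w_coeffs_leading
  by auto

lemma w_eventually_nonzero:
  assumes "\<epsilon> > 0"
  shows "eventually (\<lambda>z. w j z \<noteq> 0) (sector_inf \<epsilon>)"
proof -
  have "((\<lambda>z. z ^ N (Suc j) * w j z) \<longlongrightarrow> of_real (- g j)) (sector_inf \<epsilon>)"
    using has_expansion_tendsto[OF sector_inf_le scaled_w_expansion(1)[OF assms]]
      scaled_w_expansion(2)[OF assms] by metis
  then have "eventually (\<lambda>z. z ^ N (Suc j) * w j z \<noteq> 0) (sector_inf \<epsilon>)"
    by (rule tendsto_imp_eventually_ne) (simp add: g_nonzero)
  then show ?thesis by eventually_elim auto
qed

end

section \<open>The continued fraction\<close>

lemma has_expansion_divide_power: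
  assumes G: "G \<le> at_infinity" and f: "has_expansion G f A"
  shows "has_expansion G (\<lambda>z. f z / z ^ k) (fps_X ^ k * A)"
proof (induction k)
  case (Suc k)
  from has_expansion_times_inverse[OF G Suc]
  show ?case by (simp add: mult_ac)
qed (use f in simp)

lemma first_nonzero_eqI:
  assumes "\<And>i. i < m \<Longrightarrow> t i = 0" "t m \<noteq> 0"
  shows "first_nonzero t = t m"
proof -
  have "(LEAST i. t i \<noteq> 0) = m"
    using assms by (intro Least_equality) (auto simp: not_less[symmetric])
  then show ?thesis by (simp add: first_nonzero_def)
qed

lemma hankel_det_scale: "hankel_det (\<lambda>i. t i / a) n = (1 / a) ^ n * hankel_det t n"
proof -
  have "Matrix.mat n n (\<lambda>(i, k). t (i + k) / a) = (1 / a) \<cdot>\<^sub>m Matrix.mat n n (\<lambda>(i, k). t (i + k))"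
    by (rule eq_matI) auto
  then show ?thesis by (simp add: hankel_det_def)
qed

lemma normal_index_scale:
  assumes "a \<noteq> 0"
  shows "normal_index (\<lambda>i. t i / a) = normal_index t"
  using assms by (simp add: normal_index_def hankel_det_scale)

lemma asymp_expansion_cong:
  assumes "\<And>z. z \<in> UHP \<Longrightarrow> f z = g z"
  shows "asymp_expansion f t \<longleftrightarrow> asymp_expansion g t"
proof -
  have "(\<lambda>z. f z + (\<Sum>j\<le>2*n. of_real (t j) / z ^ (j + 1))) \<in> o[sector_inf \<epsilon>](\<lambda>z. 1 / z ^ (2*n + 1)) \<longleftrightarrow>
        (\<lambda>z. g z + (\<Sum>j\<le>2*n. of_real (t j) / z ^ (j + 1))) \<in> o[sector_inf \<epsilon>](\<lambda>z. 1 / z ^ (2*n + 1))"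
    if "\<epsilon> > 0" for \<epsilon> n
    by (rule landau_o.small.in_cong) (use sector_inf_UHP[OF that] assms in \<open>auto elim: eventually_mono\<close>)
  then show ?thesis by (auto simp: asymp_expansion_def)
qed

lemma meromorphic_on_poly: "(\<lambda>z. poly q z) meromorphic_on A"
  by (induction q) (auto intro!: meromorphic_intros)

locale function_UL_factorization = UL_factorization +
  fixes F :: "complex \<Rightarrow> complex"
  assumes F_N_minf: "F \<in> N_minf"
    and F_eq: "z \<in> UHP \<Longrightarrow> F z = R 0 z"
begin

abbreviation f :: "complex \<Rightarrow> complex" where
  "f \<equiv> (\<lambda>z. F z / z - of_real s / z)"

lemma f_eq_w: "z \<in> UHP \<Longrightarrow> f z = w 0 z"
  using first_block k_small[of 0] by (auto simp: w_def F_eq N_0 diff_divide_distrib)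

lemma f_meromorphic: "f meromorphic_on UHP"
proof -
  have "F analytic_on UHP"
    using F_N_minf by (simp add: N_minf_def nevanlinna_def analytic_on_open UHP_def open_halfspace_Im_gt)
  then have "F meromorphic_on UHP" by (rule analytic_on_imp_meromorphic_on)
  then show ?thesis by (intro meromorphic_intros)
qed

lemma w_0_coeffs: "fps_nth (w_coeffs 0) (Suc i) = - case_nat s (moment \<sigma>) i" "fps_nth (w_coeffs 0) 0 = 0"
proof -
  have "cauchy_coeffs (P 0) = Abs_fps (case_nat 0 (\<lambda>j. - moment \<sigma> j))"
    by (rule fps_ext) (auto simp: cauchy_coeffs_def P_0 integral_poly_monom split: nat.split)
  then show "fps_nth (w_coeffs 0) (Suc i) = - case_nat s (moment \<sigma>) i"
    using first_block k_small[of 0] by (auto simp: w_coeffs_def N_0 split: nat.split)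
qed (simp add: w_coeffs_def)

lemma f_asymp: "asymp_expansion f (case_nat s (moment \<sigma>))"
proof -
  have "asymp_expansion (w 0) (case_nat s (moment \<sigma>))"
    by (rule asymp_expansionI[OF w_expansion]) (simp_all add: w_0_coeffs)
  then show ?thesis using asymp_expansion_cong[of f "w 0"] f_eq_w by simp
qed

lemma f_in_D_plus: "f \<in> D_plus_minf"
proof -
  have eq: "z * f z + of_real s = F z" if "z \<in> UHP" for z
    using UHP_nonzero[OF that] by (simp add: right_diff_distrib)
  have "(\<lambda>z. z * f z + of_real s) holomorphic_on UHP \<longleftrightarrow> F holomorphic_on UHP"
    by (rule holomorphic_cong) (use eq in auto)
  moreover have "(\<lambda>z. z * f z + of_real s) ` UHP = F ` UHP"
    by (rule image_cong) (use eq in auto)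
  moreover have "asymp_expansion (\<lambda>z. z * f z + of_real s) t \<longleftrightarrow> asymp_expansion F t" for t
    by (rule asymp_expansion_cong) (use eq in auto)
  moreover obtain t where "asymp_expansion F t" using F_N_minf by (auto simp: N_minf_def)
  ultimately have "(\<lambda>z. z * f z + of_real s) \<in> N_minf"
    using F_N_minf unfolding N_minf_def nevanlinna_def by auto
  then show ?thesis
    unfolding D_plus_minf_def using f_meromorphic f_asymp
    by (auto intro!: exI[of _ "case_nat s (moment \<sigma>)"])
qed

lemma F_rational_if_f_rational:
  assumes "rational_on_UHP f"
  shows "rational_on_UHP F"
proof -
  obtain p q :: "complex poly" where q: "q \<noteq> 0" and eq: "\<forall>\<^sub>\<approx>z\<in>UHP. f z = poly p z / poly q z"
    using assms unfolding rational_on_UHP_def by blast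
  have "\<forall>\<^sub>\<approx>z\<in>UHP. poly q z \<noteq> 0"
    unfolding eventually_cosparse using poly_roots_finite[OF q] by (auto intro: finite_imp_sparse)
  moreover have "\<forall>\<^sub>\<approx>z\<in>UHP. z \<in> UHP"
    by (rule eventually_in_cosparse) (auto simp: UHP_def open_halfspace_Im_gt)
  ultimately have "\<forall>\<^sub>\<approx>z\<in>UHP. F z = poly (pCons 0 p + Polynomial.smult (of_real s) q) z / poly q z"
    using eq
  proof eventually_elim
    case (elim z)
    have "F z = z * f z + of_real s" using UHP_nonzero[OF elim(2)] by (simp add: right_diff_distrib)
    also have "\<dots> = z * (poly p z / poly q z) + of_real s" by (simp only: elim(3))
    finally show ?case using elim(1) by (simp add: field_simps)
  qed
  then show ?thesis unfolding rational_on_UHP_def using q by blast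
qed

lemma first_nonzero_moments: "first_nonzero (case_nat s (moment \<sigma>)) = g 0"
proof (cases "k 0 = 1")
  case True
  then have "s \<noteq> 0" using first_block by blast
  then show ?thesis
    using True first_nonzero_eqI[of 0 "case_nat s (moment \<sigma>)"] by (simp add: g_def)
next
  case False
  then have s: "s = 0" and k: "k 0 = 2" using first_block k_small[of 0] by auto
  have "first_nonzero (case_nat s (moment \<sigma>)) = moment \<sigma> 0"
    using first_nonzero_eqI[of 1 "case_nat s (moment \<sigma>)"] mass_pos s by simp
  then show ?thesis using k by (simp add: g_def sqnorm_0 N_0)
qed

definition eps :: "nat \<Rightarrow> real" where "eps j = sgn (g j)"

lemma eps_square: "eps j * eps j = 1"
  using g_nonzero[of j] by (simp add: eps_def sgn_if)

text \<open>Since \<open>g\<^sub>j\<^sub>+\<^sub>1 = \<kappa>\<^sub>j g\<^sub>j\<close>, the signs change exactly with the sign of \<open>\<kappa>\<^sub>j\<close>.\<close>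

lemma eps_Suc: "eps (Suc j) * \<bar>\<kappa> j\<bar> = eps j * \<kappa> j" "eps (Suc j) * \<kappa> j = eps j * \<bar>\<kappa> j\<bar>"
proof -
  have "eps (Suc j) = sgn (\<kappa> j) * eps j" by (simp add: eps_def g_Suc sgn_mult)
  then show "eps (Suc j) * \<bar>\<kappa> j\<bar> = eps j * \<kappa> j" "eps (Suc j) * \<kappa> j = eps j * \<bar>\<kappa> j\<bar>"
    using sgn_mult_abs[of "\<kappa> j"] abs_sgn[of "\<kappa> j"] by (auto simp: mult_ac)
qed

text \<open>Solving the continued fraction identity for the next function makes that identity and
meromorphy immediate, whatever the values at the poles. The relation to the ratios of the
\<open>w\<^sub>j\<close> is only needed, and only proved, where these do not vanish.\<close>

primrec \<Phi> :: "nat \<Rightarrow> complex \<Rightarrow> complex" where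
  "\<Phi> 0 = (\<lambda>z. f z / of_real \<bar>g 0\<bar>)"
| "\<Phi> (Suc j) = (\<lambda>z. (- 1 / \<Phi> j z - of_real (eps j) * poly (map_poly of_real (p j)) z) / of_real \<bar>\<kappa> j\<bar>)"

lemma \<Phi>_meromorphic: "\<Phi> j meromorphic_on UHP"
proof (induction j)
  case 0
  show ?case unfolding \<Phi>.simps by (intro meromorphic_on_divide f_meromorphic meromorphic_on_const)
next
  case (Suc j)
  then show ?case unfolding \<Phi>.simps by (intro meromorphic_intros meromorphic_on_poly)
qed

text \<open>Dividing the recurrence of the \<open>w\<^sub>j\<close> by \<open>w\<^sub>j\<^sub>+\<^sub>1\<close> gives the continued fraction of their
ratios.\<close>

lemma \<Phi>_Suc_eq:
  assumes z: "z \<in> UHP" and nz: "\<And>i. i \<le> Suc j \<Longrightarrow> w i z \<noteq> 0"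
  shows "\<Phi> (Suc j) z = - of_real (eps j) * w (Suc j) z / (of_real \<bar>\<kappa> j\<bar> * w j z)"
  using nz
proof (induction j)
  case 0
  have "of_real (eps 0) * of_real (g 0) = (of_real \<bar>g 0\<bar> :: complex)"
    by (simp add: eps_def abs_sgn mult.commute flip: of_real_mult)
  moreover have "w 0 z \<noteq> 0" "of_real \<bar>\<kappa> 0\<bar> \<noteq> (0::complex)" using 0 \<kappa>_nonzero by auto
  ultimately show ?case
    using w_rec_0[OF z] f_eq_w[OF z] by (simp add: field_simps)
next
  case (Suc j)
  let ?p = "poly (map_poly of_real (p (Suc j))) z"
  have nz: "w j z \<noteq> 0" "w (Suc j) z \<noteq> 0" "of_real \<bar>\<kappa> j\<bar> \<noteq> (0::complex)" "eps j \<noteq> 0"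
    using Suc.prems[of j] Suc.prems[of "Suc j"] \<kappa>_nonzero[of j] eps_square[of j] by auto
  have ee: "of_real (eps j) * of_real (eps j) = (1::complex)"
    by (simp add: eps_square flip: of_real_mult)
  \<comment> \<open>A sign is its own inverse, so taking the reciprocal of the induction hypothesis keeps it.\<close>
  then have inv: "1 / of_real (eps j) = (of_real (eps j) :: complex)"
    using nz by (simp add: field_simps)
  have "\<Phi> (Suc j) z = - of_real (eps j) * w (Suc j) z / (of_real \<bar>\<kappa> j\<bar> * w j z)"
    using Suc by simp
  then have "- 1 / \<Phi> (Suc j) z = (1 / of_real (eps j)) * (of_real \<bar>\<kappa> j\<bar> * w j z) / w (Suc j) z"
    by (simp del: \<Phi>.simps)
  also have "\<dots> = of_real (eps j) * (of_real \<bar>\<kappa> j\<bar> * w j z) / w (Suc j) z"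
    by (simp only: inv)
  also have "\<dots> = of_real (eps (Suc j)) * (of_real (\<kappa> j) * w j z) / w (Suc j) z"
    using eps_Suc(2)[of j] by (simp flip: of_real_mult mult.assoc)
  also have "of_real (\<kappa> j) * w j z = ?p * w (Suc j) z - w (Suc (Suc j)) z"
    using w_rec_Suc[OF z, of j] by simp
  finally have "- 1 / \<Phi> (Suc j) z - of_real (eps (Suc j)) * ?p
      = - of_real (eps (Suc j)) * w (Suc (Suc j)) z / w (Suc j) z"
    using nz by (simp add: field_simps del: \<Phi>.simps)
  then show ?case unfolding \<Phi>.simps(2)[of "Suc j"] by (simp add: mult.commute del: \<Phi>.simps)
qed

lemma \<Phi>_Suc_eventually:
  assumes "\<epsilon> > 0"
  shows "eventually (\<lambda>z. \<Phi> (Suc j) z = - of_real (eps j) * w (Suc j) z / (of_real \<bar>\<kappa> j\<bar> * w j z))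
    (sector_inf \<epsilon>)"
proof -
  have "eventually (\<lambda>z. \<forall>i\<in>{..Suc j}. w i z \<noteq> 0) (sector_inf \<epsilon>)"
    using w_eventually_nonzero[OF assms] by (simp add: eventually_ball_finite_distrib)
  then show ?thesis using sector_inf_UHP[OF assms]
    by eventually_elim (rule \<Phi>_Suc_eq, auto)
qed

text \<open>Up to the constant factor, the expansion of the quotient of \<open>w\<^sub>j\<^sub>+\<^sub>1\<close> and \<open>w\<^sub>j\<close>, each multiplied by the power of
\<open>z\<close> that makes its limit finite and nonzero. The remaining power of \<open>1/z\<close> is the size of
block \<open>j + 1\<close>.\<close>

definition \<Phi>_ratio :: "nat \<Rightarrow> real fps" where
  "\<Phi>_ratio j = fps_const (- eps j / \<bar>\<kappa> j\<bar>) *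
     (fps_shift (N (Suc (Suc j))) (w_coeffs (Suc j)) * inverse (fps_shift (N (Suc j)) (w_coeffs j)))"

definition \<Phi>_coeffs :: "nat \<Rightarrow> real fps" where
  "\<Phi>_coeffs j = (case j of 0 \<Rightarrow> fps_const (1 / \<bar>g 0\<bar>) * w_coeffs 0 | Suc i \<Rightarrow> fps_X ^ k j * \<Phi>_ratio i)"

lemma \<Phi>_expansion:
  assumes "\<epsilon> > 0"
  shows "has_expansion (sector_inf \<epsilon>) (\<Phi> j) (\<Phi>_coeffs j)"
proof (cases j)
  case 0
  have "has_expansion (sector_inf \<epsilon>) (\<lambda>z. of_real (1 / \<bar>g 0\<bar>) * w 0 z) (fps_const (1 / \<bar>g 0\<bar>) * w_coeffs 0)"
    using has_expansion_lincomb[OF w_expansion w_expansion, OF assms assms, of "1 / \<bar>g 0\<bar>" 0 0 0] by simp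
  also have "?this \<longleftrightarrow> has_expansion (sector_inf \<epsilon>) (\<Phi> 0) (fps_const (1 / \<bar>g 0\<bar>) * w_coeffs 0)"
    by (rule has_expansion_cong)
       (use sector_inf_UHP[OF assms] in eventually_elim, simp add: f_eq_w)
  finally show ?thesis using 0 by (simp add: \<Phi>_coeffs_def)
next
  case (Suc i)
  let ?G = "sector_inf \<epsilon>" and ?a = "- eps i / \<bar>\<kappa> i\<bar>"
  let ?v = "\<lambda>i z. z ^ N (Suc i) * w i z" and ?V = "\<lambda>i. fps_shift (N (Suc i)) (w_coeffs i)"
  have V0: "fps_nth (?V i) 0 \<noteq> 0" using scaled_w_expansion(2)[OF assms, of i] g_nonzero[of i] by simp
  have "has_expansion ?G (?v (Suc i)) (?V (Suc i) * inverse (?V i) * ?V i)"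
    using scaled_w_expansion(1)[OF assms, of "Suc i"] inverse_mult_eq_1[OF V0] by (simp add: mult.assoc)
  from has_expansion_divide[OF sector_inf_le scaled_w_expansion(1)[OF assms] V0 this]
  have q: "has_expansion ?G (\<lambda>z. ?v (Suc i) z / ?v i z) (?V (Suc i) * inverse (?V i))" .
  have "has_expansion ?G (\<lambda>z. of_real ?a * (?v (Suc i) z / ?v i z)) (\<Phi>_ratio i)"
    using has_expansion_lincomb[OF q q, of ?a 0] by (simp add: \<Phi>_ratio_def)
  from has_expansion_divide_power[OF sector_inf_le this, of "k j"]
  have "has_expansion ?G (\<lambda>z. of_real ?a * (?v (Suc i) z / ?v i z) / z ^ k j) (\<Phi>_coeffs j)"
    by (simp add: \<Phi>_coeffs_def Suc)
  also have "?this \<longleftrightarrow> has_expansion ?G (\<Phi> j) (\<Phi>_coeffs j)"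
  proof (rule has_expansion_cong,
      use \<Phi>_Suc_eventually[OF assms, of i] eventually_nonzero[OF sector_inf_le] in eventually_elim)
    case (elim z)
    have "z ^ N (Suc (Suc i)) = z ^ N (Suc i) * z ^ k j" using n_Suc[of "Suc i"] Suc by (simp add: power_add)
    then show ?case using elim Suc by (simp add: field_simps)
  qed
  finally show ?thesis .
qed

text \<open>The leading coefficients of the \<open>w\<^sub>j\<close> have quotient \<open>\<kappa>\<^sub>j\<close>, so division by \<open>|\<kappa>\<^sub>j|\<close> leaves a
sign. This is the normalization required of every function of the continued fraction.\<close>

lemma \<Phi>_ratio_0: "fps_nth (\<Phi>_ratio j) 0 = - eps (Suc j)"
proof -
  have "fps_nth (\<Phi>_ratio j) 0 = (- eps j / \<bar>\<kappa> j\<bar>) * (g (Suc j) / g j)"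
    using w_coeffs_leading(2)[of j] w_coeffs_leading(2)[of "Suc j"]
    by (simp add: \<Phi>_ratio_def fps_inverse_nth_0 divide_inverse)
  also have "\<dots> = - (eps j * \<kappa> j) / \<bar>\<kappa> j\<bar>" using g_nonzero[of j] by (simp add: g_Suc)
  also have "\<dots> = - eps (Suc j)" using \<kappa>_nonzero[of j] by (simp flip: eps_Suc(1))
  finally show ?thesis .
qed

definition S :: "nat \<Rightarrow> nat \<Rightarrow> real" where
  "S j i = - fps_nth (\<Phi>_coeffs j) (Suc i)"

lemma k_pos: "0 < k j"
  using k_small[of j] by auto

lemma \<Phi>_coeffs_0: "fps_nth (\<Phi>_coeffs j) 0 = 0"
  using k_pos[of j] by (cases j) (auto simp: \<Phi>_coeffs_def w_0_coeffs fps_X_power_mult_nth)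

lemma \<Phi>_asymp: "asymp_expansion (\<Phi> j) (S j)"
  by (rule asymp_expansionI[OF \<Phi>_expansion]) (simp_all add: \<Phi>_coeffs_0 S_def)

lemma S_0: "S 0 = (\<lambda>i. case_nat s (moment \<sigma>) i / \<bar>g 0\<bar>)"
  by (rule ext) (simp add: S_def \<Phi>_coeffs_def w_0_coeffs)

lemma first_nonzero_S: "first_nonzero (S j) = eps j"
proof (cases j)
  case 0
  have "first_nonzero (S 0) = first_nonzero (case_nat s (moment \<sigma>)) / \<bar>g 0\<bar>"
    using g_nonzero[of 0] by (simp add: S_0 first_nonzero_def)
  then show ?thesis using 0 by (simp add: first_nonzero_moments eps_def sgn_if)
next
  case (Suc i)
  have S: "S j m = (if Suc m < k j then 0 else - fps_nth (\<Phi>_ratio i) (Suc m - k j))" for m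
    by (simp add: S_def \<Phi>_coeffs_def Suc fps_X_power_mult_nth)
  have "eps j \<noteq> 0" using eps_square[of j] by auto
  moreover have last: "S j (k j - 1) = eps j" using k_pos[of j] \<Phi>_ratio_0[of i] S[of "k j - 1"] Suc by simp
  ultimately have "first_nonzero (S j) = S j (k j - 1)"
    by (intro first_nonzero_eqI) (auto simp: S)
  then show ?thesis using last by simp
qed

lemma p_degree: "Polynomial.degree (p j) = k j" "lead_coeff (p j) = 1"
  using k_small[of j] by (auto simp: LU_poly_def Let_def)

lemma continued_fraction_f:
  "continued_fraction (\<lambda>z. f z / of_real \<bar>g 0\<bar>) \<Phi> S eps p (\<lambda>j. sqrt \<bar>\<kappa> j\<bar>)"
  unfolding continued_fraction_def
proof (intro conjI allI impI)
  show "\<Phi> 0 = (\<lambda>z. f z / of_real \<bar>g 0\<bar>)" by simp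
  fix j
  have remainder: "- 1 / \<Phi> j z - of_real (eps j) * poly (map_poly of_real (p j)) z = of_real \<bar>\<kappa> j\<bar> * \<Phi> (Suc j) z"
    for z using \<kappa>_nonzero[of j] by simp
  show "\<Phi> j meromorphic_on UHP" by (rule \<Phi>_meromorphic)
  show "asymp_expansion (\<Phi> j) (S j)" by (rule \<Phi>_asymp)
  show "eps j = first_nonzero (S j)" by (simp add: first_nonzero_S)
  show "\<bar>eps j\<bar> = 1" using g_nonzero[of j] by (simp add: eps_def abs_sgn_eq)
  show "Polynomial.degree (p j) = block_size (normal_index (S 0)) j"
    using g_nonzero[of 0] by (simp add: S_0 normal_index_scale p_degree)
  show "lead_coeff (p j) = 1" by (rule p_degree)
  show "0 < sqrt \<bar>\<kappa> j\<bar>" using \<kappa>_nonzero[of j] by simp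
  show "((\<lambda>z. - 1 / \<Phi> j z - of_real (eps j) * poly (map_poly of_real (p j)) z) \<longlongrightarrow> 0) (sector_inf \<delta>)"
    if "\<delta> > 0" for \<delta>
    unfolding remainder
    using tendsto_mult_right_zero[of "\<Phi> (Suc j)"] has_expansion_tendsto[OF sector_inf_le \<Phi>_expansion[OF that], of "Suc j"]
    by (simp only: \<Phi>_coeffs_0 of_real_0)
  show "\<forall>\<^sub>\<approx>z\<in>UHP. - 1 / \<Phi> j z = of_real (eps j) * poly (map_poly of_real (p j)) z
      + of_real ((sqrt \<bar>\<kappa> j\<bar>)\<^sup>2) * \<Phi> (Suc j) z"
    using remainder by (intro always_eventually allI) (simp add: algebra_simps del: \<Phi>.simps)
qed

lemma monic_GJM_of_f:
  assumes "\<not> rational_on_UHP F"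
  shows "monic_GJM_of f (inf_mat_mult (block_matrix N (L_blocks k e l)) (block_matrix N (U_blocks k u)))"
proof -
  have "eps j * eps (Suc j) * (sqrt \<bar>\<kappa> j\<bar>)\<^sup>2 = \<kappa> j" for j
    using eps_Suc(1)[of j] eps_square[of j] by (simp add: mult.assoc)
  moreover have "normal_index (S 0) = N"
    using g_nonzero[of 0] by (simp add: S_0 normal_index_scale)
  ultimately have "let n = normal_index (S 0); c = (\<lambda>j. eps j * eps (Suc j) * (sqrt \<bar>\<kappa> j\<bar>)\<^sup>2)
      in inf_mat_mult (block_matrix N (L_blocks k e l)) (block_matrix N (U_blocks k u))
         = block_matrix n (GJM_blocks (block_size n) p c)"
    unfolding Let_def by (simp only: LU_eq_GJM \<kappa>_def)
  with continued_fraction_f have "normalized_GJM (\<lambda>z. f z / of_real \<bar>g 0\<bar>)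
      (inf_mat_mult (block_matrix N (L_blocks k e l)) (block_matrix N (U_blocks k u)))"
    unfolding normalized_GJM_def by blast
  then show ?thesis
    unfolding monic_GJM_of_def
    using assms F_rational_if_f_rational f_in_D_plus f_asymp first_nonzero_moments by auto
qed

end

text \<open>Positivity of the total mass, on which the positive definiteness of \<open>\<sigma>\<close> rests, comes from
\<open>F(\<i>) \<noteq> 0\<close>.\<close>

theorem theorem4p5:
  fixes F :: "complex \<Rightarrow> complex" and \<sigma> :: "real measure" and P :: "nat \<Rightarrow> real poly"
    and J U L :: "nat \<Rightarrow> nat \<Rightarrow> real" and s_m1 :: real
  assumes "F \<in> N_minf" and "\<not> rational_on_UHP F"
    and "represents \<sigma> F"
    and "jacobi_associated \<sigma> P J"
    and "block_UL_factorization \<sigma> P s_m1 J U L"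
  shows "(\<lambda>z. F z / z - of_real s_m1 / z) \<in> D_plus_minf \<and>
         monic_GJM_of (\<lambda>z. F z / z - of_real s_m1 / z) (inf_mat_mult L U)"
proof -
  obtain b c where rec: "three_term_recurrence P b c" and J: "J = monic_jacobi_matrix b c"
    using assms(4) by (auto simp: jacobi_associated_def)
  define n where "n = normal_index (case_nat s_m1 (moment \<sigma>))"
  obtain u e l where
    l: "\<And>j. 1 \<le> j \<Longrightarrow> l j = - (P_hat \<sigma> P s_m1 (n (j + 1) - 1) 0 / P_hat \<sigma> P s_m1 (n j - 1) 0)"
    and U: "U = block_matrix n (U_blocks (block_size n) u)"
    and L: "L = block_matrix n (L_blocks (block_size n) e l)"
    and UL: "J = inf_mat_mult U L"
    using assms(5) unfolding block_UL_factorization_def Let_def n_def by auto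
  interpret finite_moments \<sigma>
    using assms(3) by unfold_locales (auto simp: represents_def)
  have F: "F z = cauchy_transform 1 z" if "z \<in> UHP" for z
    using assms(3) that by (simp add: represents_def cauchy_transform_def)
  have i: "\<i> \<in> UHP" by (simp add: UHP_def)
  have "F \<i> \<in> UHP" using assms(1) i by (auto simp: N_minf_def nevanlinna_def)
  then have "0 < norm (F \<i>)" by (auto simp: UHP_def)
  also have "norm (F \<i>) \<le> moment \<sigma> 0"
    using norm_cauchy_transform_le[OF i, of 1] F[OF i] by (simp add: moment_def)
  finally interpret shifted_moments \<sigma> P b c s_m1
    using assms(4) rec by unfold_locales (auto simp: jacobi_associated_def)
  have h: "h m = P_hat \<sigma> P s_m1 m 0" for m
    by (simp add: h_def shifted_functional_def P_hat_def)
  interpret function_UL_factorization \<sigma> P b c s_m1 u e l F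
    using l UL assms(1) F by unfold_locales (simp_all add: h n_def U L J P_0)
  show ?thesis
    using f_in_D_plus monic_GJM_of_f[OF assms(2)] by (simp add: U L n_def)
qed

end
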